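(* Let $(S;A)$ be a finite set of terms and a finite set of assertions with $\mathsf{fv}(S;A)\cap\mathscr V_q=\emptyset$ and $S\vdash_{dy}\mathsf{pubs}(\beta)$ for all $\beta\in A$, let $(T;E)=\mathit{ker}(S;A)$, and let $\alpha$ be an assertion with $\mathrm{bv}(\alpha)\cap\mathsf{vars}(S;A)=\emptyset$. Then $S;A\vdash_a\alpha$ if and only if there exist $X\subseteq\mathsf{hat}(\alpha)$ and a substitution $\mu$ with domain $\mathrm{bv}(\alpha)\setminus\mathrm{bv}(X)$ such that: (a) $T\vdash_{dy}\mu(x)$ for all $x\in\mathrm{dom}(\mu)$; (b) $T;E\vdash_{eq}\mu(\beta)$ for all $\beta\in X$; (c) $T;\mu(X)\vdash_a\alpha$ via a proof using only the rules ax, $\wedge$I, $\exists$I and say; (d) for all $x\in\mathrm{dom}(\mu)$ and all $t\in\mathsf{st}(\alpha)$, $\mathrm{pos}_x(t)\subseteq\mathbb A(T\cup\mathrm{dom}(\mu),t)$.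
   Context: Terms. Fix disjoint sets $\mathscr N$ of names and $\mathscr V$ of variables; $\mathscr V$ contains a subset $\mathscr V_q$ of quantified variables. Terms: $t::=x\mid m\mid\mathsf f(t_1,\dots,t_n)$ with $x\in\mathscr V$, $m\in\mathscr N$, $\mathsf f$ an $n$-ary operator (including a public-key operator $\mathit{pk}$). $\mathsf{st}$ denotes subterms, $\mathsf{vars}$ variables. Substitutions are finite partial maps from variables to terms, acting on free variables of assertions. Term derivability $X\vdash_{dy}t$ is given by the axiom rule ($X\vdash t$ if $t\in X$), constructor rules (from $X\vdash t_1,\dots,X\vdash t_n$ infer $X\vdash\mathsf f(t_1,\dots,t_n)$) and destructor rules (from $X\vdash\mathsf f(t_1,\dots,t_n)$ and $X\vdash u_1,\dots,X\vdash u_m$ infer $X\vdash t_i$); it is assumed to satisfy normalization, the subterm property and polynomial-time decidability. $X\vdash_{dy}Y$ means $X\vdash_{dy}y$ for all $y\in Y$. Positions. $\mathrm{pos}(t)\subseteq\mathbb N^*$ is the set of positions of $t$ ($\varepsilon$ root, $pi$ the $i$-th child of $p$), $t|_p$ the subterm at $p$, $\mathrm{pos}_r(t)=\{p:t|_p=r\}$, $t[P\mapsto r]$ replaces subterms at positions in $P$ by $r$. $\mathbb A(S,t)=\{p\in\mathrm{pos}(t): S\vdash_{dy}t|_q\ \forall q\in Q_p\}$ with $Q_p=\{\varepsilon\}\cup\{qi\in\mathrm{pos}(t): q\text{ a proper prefix of }p\}$. Assertions: $\alpha::=t\doteq u\mid P(u_1,\dots,u_m)\mid t_0\twoheadleftarrow[t_1,\dots,t_n]\mid\alpha_0\wedge\alpha_1\mid\exists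 x.\alpha\mid\mathit{pk}(k)\ \mathit{says}\ \alpha$, with $t,u$ terms, $P$ a predicate symbol, $u_1,\dots,u_m,t_0\in\mathscr N\cup\mathscr V$, $t_1,\dots,t_n\in\mathscr N$, $x\in\mathscr V_q$. Atomic: not of the form $\alpha\wedge\beta$ or $\exists x.\alpha$. $\mathrm{fv},\mathrm{bv}$ free/bound variables; $\mathsf{vars}(S;A)=\mathsf{vars}(S)\cup\mathsf{vars}(A)$, $\mathsf{fv}(S;A)=\mathsf{vars}(S)\cup\mathrm{fv}(A)$; for a set $X$ of assertions $\mathrm{bv}(X)=\bigcup_{\beta\in X}\mathrm{bv}(\beta)$. $\mathsf{pubs}(\alpha)$ is the set of maximal subterms of $\alpha$ containing no variable of $\mathscr V_q$. Term positions: $\mathrm{pos}(t\doteq t')=\{0p:p\in\mathrm{pos}(t)\}\cup\{1p:p\in\mathrm{pos}(t')\}$; $\mathrm{pos}(P(u_0,\dots,u_m))=\{0,\dots,m\}$; $\mathrm{pos}(t\twoheadleftarrow[t_1,\dots,t_n])=\{0,\dots,n\}$; $\mathrm{pos}(\alpha\wedge\beta)=\{0p:p\in\mathrm{pos}(\alpha)\}\cup\{1p:p\in\mathrm{pos}(\beta)\}$; $\mathrm{pos}(\exists x.\alpha)=\{0p:p\in\mathrm{pos}(\alpha)\}$; $\mathrm{pos}(\mathit{pk}(k)\ \mathit{says}\ \alpha)=\{0,00\}\cup\{1p:p\in\mathrm{pos}(\alpha)\}$; $\mathrm{pos}_r(\alpha)$, $\alpha[P\mapsto r]$ as for terms. Abstractable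 positions: $\mathbb A(S,t_0\doteq t_1)=\{ip:p\in\mathbb A(S,t_i)\}$; $\mathbb A(S,P(u_1,\dots,u_m))=\{i: S\vdash_{dy}u_i\}$; $\mathbb A(S,t\twoheadleftarrow[\dots])=\{0\}$; $\mathbb A(S,\alpha_0\wedge\alpha_1)=\{ip:p\in\mathbb A(S,\alpha_i)\}$; $\mathbb A(S,\exists x.\alpha)=\{0p:p\in\mathbb A(S\cup\{x\},\alpha)\}$; $\mathbb A(S,\mathit{pk}(k)\ \mathit{says}\ \alpha)=\{0\}\cup\{1p:p\in\mathbb A(S,\alpha)\}$. Assertion derivability $S;A\vdash_a\alpha$ (all sequents share LHS $S;A$ unless stated): (ax) $S;A\cup\{\alpha\}\vdash\alpha$; (eq) if $S\vdash_{dy}t$ then $\vdash t\doteq t$; (cons) from $t_j\doteq u_j$ ($j\le r$) infer $\mathsf f(t_1,\dots,t_r)\doteq\mathsf f(u_1,\dots,u_r)$; (sym) from $t\doteq u$ infer $u\doteq t$; (trans) from $t_1\doteq t_2,\dots,t_k\doteq t_{k+1}$ infer $t_1\doteq t_{k+1}$; (proj$_i$) from $\mathsf f(t_1,\dots,t_r)\doteq\mathsf f(u_1,\dots,u_r)$ infer $t_i\doteq u_i$, provided the positions of all arguments $t_j,u_j$ are abstractable positions of this assertion w.r.t. $S$; ($\wedge$I) from $\alpha_0,\alpha_1$ infer $\alpha_0\wedge\alpha_1$; ($\wedge$E$_i$) from $\alpha_0\wedge\alpha_1$ infer $\alpha_i$; (subst) from $t\twoheadleftarrow l$ and $t\doteq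 u$ infer $u\twoheadleftarrow l$; ($\exists$I) from $\alpha[P\mapsto t]$ and $S\vdash_{dy}t$ infer $\exists x.\alpha$, where $P=\mathrm{pos}_x(\alpha)\subseteq\mathbb A(S\cup\{x\},\alpha)$; ($\exists$E) from $S;A\vdash\exists x.\alpha$ and $S\cup\{y\};A\cup\{\alpha[P\mapsto y]\}\vdash\gamma$ infer $S;A\vdash\gamma$, where $y\notin\mathsf{vars}(S)\cup\mathrm{fv}(A)\cup\mathrm{fv}(\gamma)$ and $P=\mathrm{pos}_x(\alpha)$; (say) from $\alpha$ and $S\vdash_{dy}k$ infer $\mathit{pk}(k)\ \mathit{says}\ \alpha$; (prom) from $t\twoheadleftarrow[n]$ infer $t\doteq n$; (int) from $t\twoheadleftarrow l_1,\dots,t\twoheadleftarrow l_m$ infer $t\twoheadleftarrow(l_1\cap\dots\cap l_m)$; (wk) from $t\doteq n_i$ and $S\vdash_{dy}n_j$ for all $j$ infer $t\twoheadleftarrow[n_1,\dots,n_k]$. $S;A\vdash_{eq}\alpha$ means derivable without $\wedge$I, $\wedge$E, $\exists$I, $\exists$E, say. Kernel: $\mathsf{at}(\alpha)$ is the set of maximal atomic subformulas of $\alpha$; $\mathit{ker}(S;A)=(T;E)$ with $T=S\cup\mathrm{bv}(A)$, $E=\bigcup_{\alpha\in A}\mathsf{at}(\alpha)$. Hereditary atoms: $\mathsf{hat}(\alpha\wedge\beta)=\mathsf{hat}(\alpha)\cup\mathsf{hat}(\beta)$; $\mathsf{hat}(\exists x.\alpha)=\mathsf{hat}(\alpha)$;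 $\mathsf{hat}(\mathit{pk}(k)\ \mathit{says}\ \alpha)=\{\mathit{pk}(k)\ \mathit{says}\ \alpha\}\cup\mathsf{hat}(\alpha)$; $\mathsf{hat}(\gamma)=\{\gamma\}$ otherwise. Standing convention: no variable occurs both free and bound, and no variable is bound by two distinct quantifiers. *)

theory Defs
  imports Main "HOL-Library.Sublist"
begin

section \<open>Terms\<close>

text \<open>Names and variables are the types \<open>'n\<close> and \<open>'v\<close>, operators the type \<open>'f\<close>.\<close>

datatype ('f, 'n, 'v) trm = Var 'v | Name 'n | Fn 'f "('f, 'n, 'v) trm list"

fun vars :: "('f, 'n, 'v) trm \<Rightarrow> 'v set" where
  "vars (Var x) = {x}"
| "vars (Name n) = {}"
| "vars (Fn f ts) = (\<Union>t\<in>set ts. vars t)"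

fun st :: "('f, 'n, 'v) trm \<Rightarrow> ('f, 'n, 'v) trm set" where
  "st (Var x) = {Var x}"
| "st (Name n) = {Name n}"
| "st (Fn f ts) = insert (Fn f ts) (\<Union>t\<in>set ts. st t)"

fun atomic_trm :: "('f, 'n, 'v) trm \<Rightarrow> bool" where
  "atomic_trm (Var x) = True"
| "atomic_trm (Name n) = True"
| "atomic_trm (Fn f ts) = False"

fun subst :: "('v \<rightharpoonup> ('f, 'n, 'v) trm) \<Rightarrow> ('f, 'n, 'v) trm \<Rightarrow> ('f, 'n, 'v) trm" where
  "subst \<sigma> (Var x) = (case \<sigma> x of None \<Rightarrow> Var x | Some t \<Rightarrow> t)"
| "subst \<sigma> (Name n) = Name n"
| "subst \<sigma> (Fn f ts) = Fn f (map (subst \<sigma>) ts)"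

subsection \<open>Positions\<close>

text \<open>Children are numbered from 0.\<close>

type_synonym position = "nat list"

lemma size_nth_trm [termination_simp]:
  "i < length ts \<Longrightarrow> size (ts ! i) < Suc (size_list size ts)"
  by (meson less_Suc_eq_le nth_mem order_refl size_list_estimation')

fun pos :: "('f, 'n, 'v) trm \<Rightarrow> position set" where
  "pos (Var x) = {[]}"
| "pos (Name n) = {[]}"
| "pos (Fn f ts) = insert [] (\<Union>i\<in>{..<length ts}. (\<lambda>p. i # p) ` pos (ts ! i))"

fun subterm_at :: "('f, 'n, 'v) trm \<Rightarrow> position \<Rightarrow> ('f, 'n, 'v) trm" where
  "subterm_at t [] = t"
| "subterm_at (Fn f ts) (i # p) = subterm_at (ts ! i) p"
| "subterm_at _ _ = undefined"

definition pos_of :: "('f, 'n, 'v) trm \<Rightarrow> ('f, 'n, 'v) trm \<Rightarrow> position set" where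
  "pos_of r t = {p \<in> pos t. subterm_at t p = r}"

fun replace :: "('f, 'n, 'v) trm \<Rightarrow> position set \<Rightarrow> ('f, 'n, 'v) trm \<Rightarrow> ('f, 'n, 'v) trm" where
  "replace (Var x) P r = (if [] \<in> P then r else Var x)"
| "replace (Name n) P r = (if [] \<in> P then r else Name n)"
| "replace (Fn f ts) P r = (if [] \<in> P then r
     else Fn f (map (\<lambda>i. replace (ts ! i) {p. i # p \<in> P} r) [0..<length ts]))"


section \<open>Term derivability\<close>

text \<open>
  A destructor rule is schematic: \<open>DRule f ps qs i\<close> stands for all instances of
  ``from \<open>f(ps)\<close> and the terms \<open>qs\<close> infer the \<open>i\<close>-th component of \<open>ps\<close>'',
  where \<open>ps\<close> and \<open>qs\<close> are built from metavariables (numbered by \<open>nat\<close>) and operators.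
\<close>

datatype 'f pat = Meta nat | PFn 'f "'f pat list"

datatype 'f drule = DRule 'f "'f pat list" "'f pat list" nat

fun inst :: "(nat \<Rightarrow> ('f, 'n, 'v) trm) \<Rightarrow> 'f pat \<Rightarrow> ('f, 'n, 'v) trm" where
  "inst \<theta> (Meta k) = \<theta> k"
| "inst \<theta> (PFn f ps) = Fn f (map (inst \<theta>) ps)"

text \<open>\<open>Vq\<close> is the set of quantified variables.\<close>

record ('f, 'v) signature =
  arity :: "'f \<Rightarrow> nat"
  pk :: 'f
  drules :: "'f drule set"
  Vq :: "'v set"

fun wf_trm :: "('f, 'v) signature \<Rightarrow> ('f, 'n, 'v) trm \<Rightarrow> bool" where
  "wf_trm \<Sigma> (Var x) = True"
| "wf_trm \<Sigma> (Name n) = True"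
| "wf_trm \<Sigma> (Fn f ts) = (length ts = arity \<Sigma> f \<and> (\<forall>t\<in>set ts. wf_trm \<Sigma> t))"

fun wf_pat :: "('f, 'v) signature \<Rightarrow> 'f pat \<Rightarrow> bool" where
  "wf_pat \<Sigma> (Meta k) = True"
| "wf_pat \<Sigma> (PFn f ps) = (length ps = arity \<Sigma> f \<and> (\<forall>p\<in>set ps. wf_pat \<Sigma> p))"

fun wf_drule :: "('f, 'v) signature \<Rightarrow> 'f drule \<Rightarrow> bool" where
  "wf_drule \<Sigma> (DRule f ps qs i) =
     (length ps = arity \<Sigma> f \<and> i < length ps \<and> (\<forall>p\<in>set ps \<union> set qs. wf_pat \<Sigma> p))"

definition destr ::
  "('f, 'v) signature \<Rightarrow> ('f, 'n, 'v) trm \<Rightarrow> ('f, 'n, 'v) trm list \<Rightarrow> ('f, 'n, 'v) trm \<Rightarrow> bool" where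
  "destr \<Sigma> s us t \<longleftrightarrow> (\<exists>f ps qs i \<theta>. DRule f ps qs i \<in> drules \<Sigma> \<and>
     s = Fn f (map (inst \<theta>) ps) \<and> us = map (inst \<theta>) qs \<and> t = inst \<theta> (ps ! i))"

text \<open>Proof trees; \<open>Destr t \<pi> \<pi>s\<close> has conclusion \<open>t\<close>, major premise \<open>\<pi>\<close> and minor premises \<open>\<pi>s\<close>.\<close>

datatype ('f, 'n, 'v) dyproof =
    Axiom "('f, 'n, 'v) trm"
  | Constr 'f "('f, 'n, 'v) dyproof list"
  | Destr "('f, 'n, 'v) trm" "('f, 'n, 'v) dyproof" "('f, 'n, 'v) dyproof list"

fun concl :: "('f, 'n, 'v) dyproof \<Rightarrow> ('f, 'n, 'v) trm" where
  "concl (Axiom t) = t"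
| "concl (Constr f \<pi>s) = Fn f (map concl \<pi>s)"
| "concl (Destr t \<pi> \<pi>s) = t"

fun proof_from :: "('f, 'v) signature \<Rightarrow> ('f, 'n, 'v) trm set \<Rightarrow> ('f, 'n, 'v) dyproof \<Rightarrow> bool" where
  "proof_from \<Sigma> X (Axiom t) = (t \<in> X)"
| "proof_from \<Sigma> X (Constr f \<pi>s) = (length \<pi>s = arity \<Sigma> f \<and> (\<forall>\<pi>\<in>set \<pi>s. proof_from \<Sigma> X \<pi>))"
| "proof_from \<Sigma> X (Destr t \<pi> \<pi>s) = (destr \<Sigma> (concl \<pi>) (map concl \<pi>s) t \<and>
     proof_from \<Sigma> X \<pi> \<and> (\<forall>\<rho>\<in>set \<pi>s. proof_from \<Sigma> X \<rho>))"

fun is_constr :: "('f, 'n, 'v) dyproof \<Rightarrow> bool" where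
  "is_constr (Constr f \<pi>s) = True"
| "is_constr _ = False"

fun normal :: "('f, 'n, 'v) dyproof \<Rightarrow> bool" where
  "normal (Axiom t) = True"
| "normal (Constr f \<pi>s) = (\<forall>\<pi>\<in>set \<pi>s. normal \<pi>)"
| "normal (Destr t \<pi> \<pi>s) = (\<not> is_constr \<pi> \<and> normal \<pi> \<and> (\<forall>\<rho>\<in>set \<pi>s. normal \<rho>))"

fun proof_terms :: "('f, 'n, 'v) dyproof \<Rightarrow> ('f, 'n, 'v) trm set" where
  "proof_terms (Axiom t) = {t}"
| "proof_terms (Constr f \<pi>s) = insert (Fn f (map concl \<pi>s)) (\<Union>\<pi>\<in>set \<pi>s. proof_terms \<pi>)"
| "proof_terms (Destr t \<pi> \<pi>s) = insert t (proof_terms \<pi> \<union> (\<Union>\<rho>\<in>set \<pi>s. proof_terms \<rho>))"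

definition dy :: "('f, 'v) signature \<Rightarrow> ('f, 'n, 'v) trm set \<Rightarrow> ('f, 'n, 'v) trm \<Rightarrow> bool" where
  "dy \<Sigma> X t \<longleftrightarrow> (\<exists>\<pi>. proof_from \<Sigma> X \<pi> \<and> concl \<pi> = t)"

definition normalization :: "('f, 'v) signature \<Rightarrow> 'n itself \<Rightarrow> bool" where
  "normalization \<Sigma> _ \<longleftrightarrow> (\<forall>X (t :: ('f, 'n, 'v) trm). (\<forall>s\<in>X. wf_trm \<Sigma> s) \<longrightarrow> dy \<Sigma> X t \<longrightarrow>
     (\<exists>\<pi>. proof_from \<Sigma> X \<pi> \<and> concl \<pi> = t \<and> normal \<pi>))"

text \<open>
  For a normal proof that does not end in a constructor rule this entails that its terms are
  already subterms of \<open>X\<close>, since its conclusion then is such a subterm.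
\<close>

definition subterm_property :: "('f, 'v) signature \<Rightarrow> 'n itself \<Rightarrow> bool" where
  "subterm_property \<Sigma> _ \<longleftrightarrow> (\<forall>X (\<pi> :: ('f, 'n, 'v) dyproof). (\<forall>s\<in>X. wf_trm \<Sigma> s) \<longrightarrow>
     proof_from \<Sigma> X \<pi> \<longrightarrow> normal \<pi> \<longrightarrow> proof_terms \<pi> \<subseteq> (\<Union>s\<in>insert (concl \<pi>) X. st s))"

definition dy_system :: "('f, 'v) signature \<Rightarrow> 'n itself \<Rightarrow> bool" where
  "dy_system \<Sigma> N \<longleftrightarrow> arity \<Sigma> (pk \<Sigma>) = 1 \<and> (\<forall>d\<in>drules \<Sigma>. wf_drule \<Sigma> d) \<and>
     normalization \<Sigma> N \<and> subterm_property \<Sigma> N"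

text \<open>\<open>Qpos t p\<close> is the set \<open>Q\<^sub>p\<close>.\<close>

definition Qpos :: "('f, 'n, 'v) trm \<Rightarrow> position \<Rightarrow> position set" where
  "Qpos t p = insert [] {q @ [i] | q i. q @ [i] \<in> pos t \<and> strict_prefix q p}"

definition abs_pos :: "('f, 'v) signature \<Rightarrow> ('f, 'n, 'v) trm set \<Rightarrow> ('f, 'n, 'v) trm \<Rightarrow> position set" where
  "abs_pos \<Sigma> S t = {p \<in> pos t. \<forall>q\<in>Qpos t p. dy \<Sigma> S (subterm_at t q)}"


section \<open>Assertions\<close>

text \<open>
  \<open>Mem t ns\<close> is \<open>t \<twoheadleftarrow> ns\<close>, and \<open>Says k \<alpha>\<close> is \<open>pk(k) says \<alpha>\<close>. The grammar admits only names and
  variables as arguments of \<open>Pred\<close> and \<open>Mem\<close>; this is the predicate \<open>wf_assn\<close>. The type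
  allows arbitrary terms there, because replacing a variable in an argument, applying a
  substitution, and the rules (subst) and (wk) produce assertions \<open>P(t)\<close> and \<open>t \<twoheadleftarrow> ns\<close> with \<open>t\<close> a
  compound term.
\<close>

datatype ('p, 'f, 'n, 'v) assn =
    Eq "('f, 'n, 'v) trm" "('f, 'n, 'v) trm"
  | Pred 'p "('f, 'n, 'v) trm list"
  | Mem "('f, 'n, 'v) trm" "'n list"
  | Conj "('p, 'f, 'n, 'v) assn" "('p, 'f, 'n, 'v) assn"
  | Ex 'v "('p, 'f, 'n, 'v) assn"
  | Says "('f, 'n, 'v) trm" "('p, 'f, 'n, 'v) assn"

fun wf_assn :: "('f, 'v) signature \<Rightarrow> ('p, 'f, 'n, 'v) assn \<Rightarrow> bool" where
  "wf_assn \<Sigma> (Eq t u) = (wf_trm \<Sigma> t \<and> wf_trm \<Sigma> u)"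
| "wf_assn \<Sigma> (Pred P us) = (\<forall>u\<in>set us. atomic_trm u)"
| "wf_assn \<Sigma> (Mem t ns) = atomic_trm t"
| "wf_assn \<Sigma> (Conj \<alpha> \<beta>) = (wf_assn \<Sigma> \<alpha> \<and> wf_assn \<Sigma> \<beta>)"
| "wf_assn \<Sigma> (Ex x \<alpha>) = (x \<in> Vq \<Sigma> \<and> wf_assn \<Sigma> \<alpha>)"
| "wf_assn \<Sigma> (Says k \<alpha>) = (wf_trm \<Sigma> k \<and> wf_assn \<Sigma> \<alpha>)"

fun fv :: "('p, 'f, 'n, 'v) assn \<Rightarrow> 'v set" where
  "fv (Eq t u) = vars t \<union> vars u"
| "fv (Pred P us) = (\<Union>u\<in>set us. vars u)"
| "fv (Mem t ns) = vars t"
| "fv (Conj \<alpha> \<beta>) = fv \<alpha> \<union> fv \<beta>"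
| "fv (Ex x \<alpha>) = fv \<alpha> - {x}"
| "fv (Says k \<alpha>) = vars k \<union> fv \<alpha>"

fun bv :: "('p, 'f, 'n, 'v) assn \<Rightarrow> 'v set" where
  "bv (Eq t u) = {}"
| "bv (Pred P us) = {}"
| "bv (Mem t ns) = {}"
| "bv (Conj \<alpha> \<beta>) = bv \<alpha> \<union> bv \<beta>"
| "bv (Ex x \<alpha>) = insert x (bv \<alpha>)"
| "bv (Says k \<alpha>) = bv \<alpha>"

definition bvs :: "('p, 'f, 'n, 'v) assn set \<Rightarrow> 'v set" where
  "bvs X = (\<Union>\<beta>\<in>X. bv \<beta>)"

definition vars_seq :: "('f, 'n, 'v) trm set \<Rightarrow> ('p, 'f, 'n, 'v) assn set \<Rightarrow> 'v set" where
  "vars_seq S A = (\<Union>t\<in>S. vars t) \<union> (\<Union>\<beta>\<in>A. fv \<beta> \<union> bv \<beta>)"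

definition fv_seq :: "('f, 'n, 'v) trm set \<Rightarrow> ('p, 'f, 'n, 'v) assn set \<Rightarrow> 'v set" where
  "fv_seq S A = (\<Union>t\<in>S. vars t) \<union> (\<Union>\<beta>\<in>A. fv \<beta>)"

fun st_assn :: "('f, 'v) signature \<Rightarrow> ('p, 'f, 'n, 'v) assn \<Rightarrow> ('f, 'n, 'v) trm set" where
  "st_assn \<Sigma> (Eq t u) = st t \<union> st u"
| "st_assn \<Sigma> (Pred P us) = (\<Union>u\<in>set us. st u)"
| "st_assn \<Sigma> (Mem t ns) = st t \<union> Name ` set ns"
| "st_assn \<Sigma> (Conj \<alpha> \<beta>) = st_assn \<Sigma> \<alpha> \<union> st_assn \<Sigma> \<beta>"
| "st_assn \<Sigma> (Ex x \<alpha>) = st_assn \<Sigma> \<alpha>"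
| "st_assn \<Sigma> (Says k \<alpha>) = st (Fn (pk \<Sigma>) [k]) \<union> st_assn \<Sigma> \<alpha>"

definition pubs :: "('f, 'v) signature \<Rightarrow> ('p, 'f, 'n, 'v) assn \<Rightarrow> ('f, 'n, 'v) trm set" where
  "pubs \<Sigma> \<alpha> = {t \<in> st_assn \<Sigma> \<alpha>. vars t \<inter> Vq \<Sigma> = {} \<and>
     (\<forall>t'\<in>st_assn \<Sigma> \<alpha>. vars t' \<inter> Vq \<Sigma> = {} \<longrightarrow> t \<in> st t' \<longrightarrow> t' = t)}"

fun subst_assn ::
  "('v \<rightharpoonup> ('f, 'n, 'v) trm) \<Rightarrow> ('p, 'f, 'n, 'v) assn \<Rightarrow> ('p, 'f, 'n, 'v) assn" where
  "subst_assn \<sigma> (Eq t u) = Eq (subst \<sigma> t) (subst \<sigma> u)"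
| "subst_assn \<sigma> (Pred P us) = Pred P (map (subst \<sigma>) us)"
| "subst_assn \<sigma> (Mem t ns) = Mem (subst \<sigma> t) ns"
| "subst_assn \<sigma> (Conj \<alpha> \<beta>) = Conj (subst_assn \<sigma> \<alpha>) (subst_assn \<sigma> \<beta>)"
| "subst_assn \<sigma> (Ex x \<alpha>) = Ex x (subst_assn (\<sigma>(x := None)) \<alpha>)"
| "subst_assn \<sigma> (Says k \<alpha>) = Says (subst \<sigma> k) (subst_assn \<sigma> \<alpha>)"

subsection \<open>The convention on bound variables\<close>

fun distinct_bv :: "('p, 'f, 'n, 'v) assn \<Rightarrow> bool" where
  "distinct_bv (Conj \<alpha> \<beta>) = (distinct_bv \<alpha> \<and> distinct_bv \<beta> \<and> bv \<alpha> \<inter> bv \<beta> = {})"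
| "distinct_bv (Ex x \<alpha>) = (x \<notin> bv \<alpha> \<and> distinct_bv \<alpha>)"
| "distinct_bv (Says k \<alpha>) = distinct_bv \<alpha>"
| "distinct_bv _ = True"

definition regular :: "('p, 'f, 'n, 'v) assn \<Rightarrow> bool" where
  "regular \<alpha> \<longleftrightarrow> fv \<alpha> \<inter> bv \<alpha> = {} \<and> distinct_bv \<alpha>"

definition bv_convention :: "('f, 'n, 'v) trm set \<Rightarrow> ('p, 'f, 'n, 'v) assn set \<Rightarrow> bool" where
  "bv_convention S A \<longleftrightarrow> fv_seq S A \<inter> bvs A = {} \<and> (\<forall>\<beta>\<in>A. distinct_bv \<beta>) \<and>
     (\<forall>\<beta>\<in>A. \<forall>\<gamma>\<in>A. \<beta> \<noteq> \<gamma> \<longrightarrow> bv \<beta> \<inter> bv \<gamma> = {})"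

subsection \<open>Positions in assertions\<close>

text \<open>
  When the arguments of \<open>Pred\<close> and \<open>Mem\<close> and the key of \<open>Says\<close> are atomic, the positions of
  these assertions are \<open>{0, \<dots>, m}\<close>, \<open>{0, \<dots>, n}\<close> and \<open>{0, 00} \<union> {1p. p \<in> pos(\<alpha>)}\<close>. Inside compound
  arguments all term positions are counted but none below the root is abstractable, so no
  variable occurring there can be quantified by (\<open>\<exists>I\<close>).
\<close>

fun pos_assn :: "('f, 'v) signature \<Rightarrow> ('p, 'f, 'n, 'v) assn \<Rightarrow> position set" where
  "pos_assn \<Sigma> (Eq t u) = {0 # p | p. p \<in> pos t} \<union> {1 # p | p. p \<in> pos u}"
| "pos_assn \<Sigma> (Pred P us) = {i # p | i p. i < length us \<and> p \<in> pos (us ! i)}"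
| "pos_assn \<Sigma> (Mem t ns) = {0 # p | p. p \<in> pos t} \<union> {[Suc i] | i. i < length ns}"
| "pos_assn \<Sigma> (Conj \<alpha> \<beta>) = {0 # p | p. p \<in> pos_assn \<Sigma> \<alpha>} \<union> {1 # p | p. p \<in> pos_assn \<Sigma> \<beta>}"
| "pos_assn \<Sigma> (Ex x \<alpha>) = {0 # p | p. p \<in> pos_assn \<Sigma> \<alpha>}"
| "pos_assn \<Sigma> (Says k \<alpha>) =
     {0 # p | p. p \<in> pos (Fn (pk \<Sigma>) [k])} \<union> {1 # p | p. p \<in> pos_assn \<Sigma> \<alpha>}"

fun subterm_at_assn ::
  "('f, 'v) signature \<Rightarrow> ('p, 'f, 'n, 'v) assn \<Rightarrow> position \<Rightarrow> ('f, 'n, 'v) trm" where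
  "subterm_at_assn \<Sigma> (Eq t u) (i # p) = (if i = 0 then subterm_at t p else subterm_at u p)"
| "subterm_at_assn \<Sigma> (Pred P us) (i # p) = subterm_at (us ! i) p"
| "subterm_at_assn \<Sigma> (Mem t ns) (i # p) =
     (if i = 0 then subterm_at t p else Name (ns ! (i - 1)))"
| "subterm_at_assn \<Sigma> (Conj \<alpha> \<beta>) (i # p) =
     (if i = 0 then subterm_at_assn \<Sigma> \<alpha> p else subterm_at_assn \<Sigma> \<beta> p)"
| "subterm_at_assn \<Sigma> (Ex x \<alpha>) (i # p) = subterm_at_assn \<Sigma> \<alpha> p"
| "subterm_at_assn \<Sigma> (Says k \<alpha>) (i # p) =
     (if i = 0 then subterm_at (Fn (pk \<Sigma>) [k]) p else subterm_at_assn \<Sigma> \<alpha> p)"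
| "subterm_at_assn \<Sigma> _ [] = undefined"

definition pos_of_assn ::
  "('f, 'v) signature \<Rightarrow> ('f, 'n, 'v) trm \<Rightarrow> ('p, 'f, 'n, 'v) assn \<Rightarrow> position set" where
  "pos_of_assn \<Sigma> r \<alpha> = {p \<in> pos_assn \<Sigma> \<alpha>. subterm_at_assn \<Sigma> \<alpha> p = r}"

text \<open>
  \<open>\<alpha>[P \<mapsto> r]\<close>. It is only used with \<open>P\<close> the positions of a variable, which contain neither a
  position of a listed name in \<open>Mem\<close> nor the position 0 of the term \<open>pk(k)\<close> in \<open>Says\<close>.
\<close>

fun replace_assn ::
  "('p, 'f, 'n, 'v) assn \<Rightarrow> position set \<Rightarrow> ('f, 'n, 'v) trm \<Rightarrow> ('p, 'f, 'n, 'v) assn" where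
  "replace_assn (Eq t u) P r = Eq (replace t {p. 0 # p \<in> P} r) (replace u {p. 1 # p \<in> P} r)"
| "replace_assn (Pred R us) P r =
     Pred R (map (\<lambda>i. replace (us ! i) {p. i # p \<in> P} r) [0..<length us])"
| "replace_assn (Mem t ns) P r = Mem (replace t {p. 0 # p \<in> P} r) ns"
| "replace_assn (Conj \<alpha> \<beta>) P r =
     Conj (replace_assn \<alpha> {p. 0 # p \<in> P} r) (replace_assn \<beta> {p. 1 # p \<in> P} r)"
| "replace_assn (Ex x \<alpha>) P r = Ex x (replace_assn \<alpha> {p. 0 # p \<in> P} r)"
| "replace_assn (Says k \<alpha>) P r =
     Says (replace k {p. 0 # 0 # p \<in> P} r) (replace_assn \<alpha> {p. 1 # p \<in> P} r)"

fun abs_pos_assn ::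
  "('f, 'v) signature \<Rightarrow> ('f, 'n, 'v) trm set \<Rightarrow> ('p, 'f, 'n, 'v) assn \<Rightarrow> position set" where
  "abs_pos_assn \<Sigma> S (Eq t u) =
     {0 # p | p. p \<in> abs_pos \<Sigma> S t} \<union> {1 # p | p. p \<in> abs_pos \<Sigma> S u}"
| "abs_pos_assn \<Sigma> S (Pred P us) = {[i] | i. i < length us \<and> dy \<Sigma> S (us ! i)}"
| "abs_pos_assn \<Sigma> S (Mem t ns) = {[0]}"
| "abs_pos_assn \<Sigma> S (Conj \<alpha> \<beta>) =
     {0 # p | p. p \<in> abs_pos_assn \<Sigma> S \<alpha>} \<union> {1 # p | p. p \<in> abs_pos_assn \<Sigma> S \<beta>}"
| "abs_pos_assn \<Sigma> S (Ex x \<alpha>) = {0 # p | p. p \<in> abs_pos_assn \<Sigma> (S \<union> {Var x}) \<alpha>}"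
| "abs_pos_assn \<Sigma> S (Says k \<alpha>) = {[0]} \<union> {1 # p | p. p \<in> abs_pos_assn \<Sigma> S \<alpha>}"


section \<open>Assertion derivability\<close>

datatype rule_name =
  R_ax | R_eq | R_cons | R_sym | R_trans | R_proj | R_conjI | R_conjE | R_subst
  | R_exI | R_exE | R_say | R_prom | R_int | R_wk

text \<open>
  \<open>derives \<Sigma> R S A \<alpha>\<close>: there is a derivation of \<open>S; A \<turnstile> \<alpha>\<close> that uses only rules in \<open>R\<close>.

  The convention on bound variables is maintained along derivations: the assertions introduced
  by (\<open>\<and>I\<close>), (\<open>\<exists>I\<close>) and (say) must be \<open>regular\<close>, and the replacement of \<open>x\<close> in (\<open>\<exists>I\<close>) and (\<open>\<exists>E\<close>) must
  not capture variables. Without the latter, \<open>\<exists>x. \<exists>z. P(x, z)\<close> would entail \<open>\<exists>z. P(z, z)\<close>.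

  In (int) the intersection is that of the sets of names listed.
\<close>

inductive derives ::
  "('f, 'v) signature \<Rightarrow> rule_name set \<Rightarrow> ('f, 'n, 'v) trm set \<Rightarrow> ('p, 'f, 'n, 'v) assn set \<Rightarrow>
   ('p, 'f, 'n, 'v) assn \<Rightarrow> bool"
  for \<Sigma> :: "('f, 'v) signature" and R :: "rule_name set"
where
  ax: "R_ax \<in> R \<Longrightarrow> \<alpha> \<in> A \<Longrightarrow> derives \<Sigma> R S A \<alpha>"
| eq: "R_eq \<in> R \<Longrightarrow> dy \<Sigma> S t \<Longrightarrow> derives \<Sigma> R S A (Eq t t)"
| cons: "R_cons \<in> R \<Longrightarrow> length ts = arity \<Sigma> f \<Longrightarrow> length us = arity \<Sigma> f \<Longrightarrow>
    (\<forall>j < arity \<Sigma> f. derives \<Sigma> R S A (Eq (ts ! j) (us ! j))) \<Longrightarrow>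
    derives \<Sigma> R S A (Eq (Fn f ts) (Fn f us))"
| sym: "R_sym \<in> R \<Longrightarrow> derives \<Sigma> R S A (Eq t u) \<Longrightarrow> derives \<Sigma> R S A (Eq u t)"
| trans: "R_trans \<in> R \<Longrightarrow> length ts = Suc k \<Longrightarrow> k \<ge> 1 \<Longrightarrow>
    (\<forall>j < k. derives \<Sigma> R S A (Eq (ts ! j) (ts ! Suc j))) \<Longrightarrow>
    derives \<Sigma> R S A (Eq (ts ! 0) (ts ! k))"
| proj: "R_proj \<in> R \<Longrightarrow> derives \<Sigma> R S A (Eq (Fn f ts) (Fn f us)) \<Longrightarrow>
    length ts = arity \<Sigma> f \<Longrightarrow> length us = arity \<Sigma> f \<Longrightarrow> i < arity \<Sigma> f \<Longrightarrow>
    (\<forall>j < arity \<Sigma> f. {[0, j], [1, j]} \<subseteq>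
       abs_pos_assn \<Sigma> S (Eq (Fn f ts) (Fn f us) :: ('p, 'f, 'n, 'v) assn)) \<Longrightarrow>
    derives \<Sigma> R S A (Eq (ts ! i) (us ! i))"
| conjI: "R_conjI \<in> R \<Longrightarrow> derives \<Sigma> R S A \<alpha> \<Longrightarrow> derives \<Sigma> R S A \<beta> \<Longrightarrow> regular (Conj \<alpha> \<beta>) \<Longrightarrow>
    derives \<Sigma> R S A (Conj \<alpha> \<beta>)"
| conjE1: "R_conjE \<in> R \<Longrightarrow> derives \<Sigma> R S A (Conj \<alpha> \<beta>) \<Longrightarrow> derives \<Sigma> R S A \<alpha>"
| conjE2: "R_conjE \<in> R \<Longrightarrow> derives \<Sigma> R S A (Conj \<alpha> \<beta>) \<Longrightarrow> derives \<Sigma> R S A \<beta>"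
| subst: "R_subst \<in> R \<Longrightarrow> derives \<Sigma> R S A (Mem t ns) \<Longrightarrow> derives \<Sigma> R S A (Eq t u) \<Longrightarrow>
    derives \<Sigma> R S A (Mem u ns)"
| exI: "R_exI \<in> R \<Longrightarrow> P = pos_of_assn \<Sigma> (Var x) \<alpha> \<Longrightarrow>
    derives \<Sigma> R S A (replace_assn \<alpha> P t) \<Longrightarrow> dy \<Sigma> S t \<Longrightarrow>
    P \<subseteq> abs_pos_assn \<Sigma> (S \<union> {Var x}) \<alpha> \<Longrightarrow>
    x \<in> Vq \<Sigma> \<Longrightarrow> regular (Ex x \<alpha>) \<Longrightarrow> vars t \<inter> bv \<alpha> = {} \<Longrightarrow>
    derives \<Sigma> R S A (Ex x \<alpha>)"
| exE: "R_exE \<in> R \<Longrightarrow> P = pos_of_assn \<Sigma> (Var x) \<alpha> \<Longrightarrow>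
    derives \<Sigma> R S A (Ex x \<alpha>) \<Longrightarrow>
    derives \<Sigma> R (S \<union> {Var y}) (A \<union> {replace_assn \<alpha> P (Var y)}) \<gamma> \<Longrightarrow>
    y \<notin> fv_seq S A \<union> fv \<gamma> \<Longrightarrow> y \<notin> bv \<alpha> \<Longrightarrow>
    derives \<Sigma> R S A \<gamma>"
| say: "R_say \<in> R \<Longrightarrow> derives \<Sigma> R S A \<alpha> \<Longrightarrow> dy \<Sigma> S k \<Longrightarrow> regular (Says k \<alpha>) \<Longrightarrow>
    derives \<Sigma> R S A (Says k \<alpha>)"
| prom: "R_prom \<in> R \<Longrightarrow> derives \<Sigma> R S A (Mem t [n]) \<Longrightarrow> derives \<Sigma> R S A (Eq t (Name n))"
| int: "R_int \<in> R \<Longrightarrow> ls \<noteq> [] \<Longrightarrow> (\<forall>l\<in>set ls. derives \<Sigma> R S A (Mem t l)) \<Longrightarrow>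
    set ns = (\<Inter>l\<in>set ls. set l) \<Longrightarrow> derives \<Sigma> R S A (Mem t ns)"
| wk: "R_wk \<in> R \<Longrightarrow> n \<in> set ns \<Longrightarrow> derives \<Sigma> R S A (Eq t (Name n)) \<Longrightarrow>
    (\<forall>n'\<in>set ns. dy \<Sigma> S (Name n')) \<Longrightarrow> derives \<Sigma> R S A (Mem t ns)"

abbreviation derives_a where
  "derives_a \<Sigma> \<equiv> derives \<Sigma> UNIV"

abbreviation derives_eq where
  "derives_eq \<Sigma> \<equiv> derives \<Sigma> (UNIV - {R_conjI, R_conjE, R_exI, R_exE, R_say})"

abbreviation derives_intro where
  "derives_intro \<Sigma> \<equiv> derives \<Sigma> {R_ax, R_conjI, R_exI, R_say}"


section \<open>Kernel and hereditary atoms\<close>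

fun at :: "('p, 'f, 'n, 'v) assn \<Rightarrow> ('p, 'f, 'n, 'v) assn set" where
  "at (Conj \<alpha> \<beta>) = at \<alpha> \<union> at \<beta>"
| "at (Ex x \<alpha>) = at \<alpha>"
| "at \<gamma> = {\<gamma>}"

definition ker :: "('f, 'n, 'v) trm set \<Rightarrow> ('p, 'f, 'n, 'v) assn set \<Rightarrow>
    ('f, 'n, 'v) trm set \<times> ('p, 'f, 'n, 'v) assn set" where
  "ker S A = (S \<union> Var ` bvs A, (\<Union>\<alpha>\<in>A. at \<alpha>))"

fun hat :: "('p, 'f, 'n, 'v) assn \<Rightarrow> ('p, 'f, 'n, 'v) assn set" where
  "hat (Conj \<alpha> \<beta>) = hat \<alpha> \<union> hat \<beta>"
| "hat (Ex x \<alpha>) = hat \<alpha>"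
| "hat (Says k \<alpha>) = insert (Says k \<alpha>) (hat \<alpha>)"
| "hat \<gamma> = {\<gamma>}"

end

theory Submission
  imports Defs
begin

text \<open>
  Instead of normalizing derivations, we interpret assertions over the kernel \<open>(T; E)\<close>: atoms hold
  if they are derivable by the equality rules, \<open>\<exists>x. \<alpha>\<close> holds if some \<open>T\<close>-derivable term is a witness,
  and \<open>pk(k) says \<alpha>\<close> holds if it belongs to \<open>E\<close> or if \<open>k\<close> is derivable and \<open>\<alpha>\<close> holds. All rules are
  sound for this interpretation, and if \<open>\<alpha>\<close> holds then the witnesses chosen for its quantifiers
  form \<open>\<mu>\<close> and the atoms reached form \<open>X\<close>. Working with environments rather than substituting
  into derivations avoids any renaming of bound variables.

  Conversely, (\<open>\<and>E\<close>) and (\<open>\<exists>E\<close>) unfold \<open>(S; A)\<close> into its kernel, each (\<open>\<exists>E\<close>) using the bound variable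
  itself as eigenvariable. The kernel moreover contains the variables bound below \<open>says\<close>, which
  cannot be freed; in the derivation they are replaced by some derivable term, which exists
  because \<open>S\<close> derives the public terms of \<open>A\<close>.
\<close>

section \<open>Term derivability\<close>

text \<open>Three obstacles shape the proof. Weakening does not go through by induction for
  derivations with (\<exists>E): the enlarged sequent may contain the eigenvariable. Cut and
  substitution into derivations are therefore proved for rule sets without (\<exists>E), which is
  enough for composing (b) and (c); where (\<exists>E) is applied, closure under weakening is
  carried along as a property of single assertions (\<open>derives_stably\<close>). Condition (d)
  speaks of \<alpha> itself, but a subformula is met only under an environment that has instantiated
  the outer quantifiers. Abstractability is pulled back from the instance, which works because the
  variables instantiated earlier are already known to be abstractable. The binders
  \<open>D = bv \<alpha>\<close> of the goal do not occur in (T; E), so witnesses never mention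
  them. Moreover, an instance of a \<open>says\<close> subformula of \<alpha> that belongs to E then
  has no quantifier, so the X found contains no bound variable and \<mu> is defined on all of
  \<open>bv \<alpha>\<close>. Substitutions are total functions; finite maps return only through
  \<open>subst_assn_asub\<close>.\<close>

primrec tsub :: "('v \<Rightarrow> ('f, 'n, 'v) trm) \<Rightarrow> ('f, 'n, 'v) trm \<Rightarrow> ('f, 'n, 'v) trm" where
  "tsub \<sigma> (Var x) = \<sigma> x"
| "tsub \<sigma> (Name n) = Name n"
| "tsub \<sigma> (Fn f ts) = Fn f (map (tsub \<sigma>) ts)"

lemma tsub_cong: "(\<And>x. x \<in> vars t \<Longrightarrow> \<sigma> x = \<tau> x) \<Longrightarrow> tsub \<sigma> t = tsub \<tau> t"
  by (induction t) auto

lemma tsub_Var [simp]: "tsub Var t = t"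
  by (induction t) (auto intro: map_idI)

lemma tsub_tsub: "tsub \<sigma> (tsub \<tau> t) = tsub (\<lambda>x. tsub \<sigma> (\<tau> x)) t"
  by (induction t) auto

lemma vars_tsub: "vars (tsub \<sigma> t) = (\<Union>x\<in>vars t. vars (\<sigma> x))"
  by (induction t) auto

lemma tsub_inst: "tsub \<sigma> (inst \<theta> p) = inst (\<lambda>k. tsub \<sigma> (\<theta> k)) p"
  by (induction p) auto

text \<open>Destructor rules are schematic, so composing the instantiation \<open>\<theta>\<close>
  with \<open>\<sigma>\<close> gives another instance of the same rule.\<close>

lemma destr_tsub: "destr \<Sigma> s us t \<Longrightarrow> \<forall>d\<in>drules \<Sigma>. wf_drule \<Sigma> d \<Longrightarrow>
    destr \<Sigma> (tsub \<sigma> s) (map (tsub \<sigma>) us) (tsub \<sigma> t)"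
  unfolding destr_def by (fastforce simp: tsub_inst)

lemma dy_ax: "t \<in> X \<Longrightarrow> dy \<Sigma> X t"
  unfolding dy_def by (rule HOL.exI[of _ "Axiom t"]) simp

lemma dy_list:
  assumes "\<forall>t\<in>set ts. dy \<Sigma> X t"
  obtains \<pi>s where "\<forall>\<pi>\<in>set \<pi>s. proof_from \<Sigma> X \<pi>" "map concl \<pi>s = ts"
proof -
  obtain f where "\<forall>t\<in>set ts. proof_from \<Sigma> X (f t) \<and> concl (f t) = t"
    using assms unfolding dy_def by metis
  then show ?thesis
    by (intro that[of "map f ts"]) (auto intro: map_idI)
qed

lemma dy_constr: "length ts = arity \<Sigma> f \<Longrightarrow> \<forall>t\<in>set ts. dy \<Sigma> X t \<Longrightarrow> dy \<Sigma> X (Fn f ts)"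
proof -
  assume "length ts = arity \<Sigma> f" and "\<forall>t\<in>set ts. dy \<Sigma> X t"
  moreover from dy_list[OF this(2)] obtain \<pi>s
    where "\<forall>\<pi>\<in>set \<pi>s. proof_from \<Sigma> X \<pi>" "map concl \<pi>s = ts" .
  ultimately show ?thesis
    unfolding dy_def by (intro HOL.exI[of _ "Constr f \<pi>s"]) auto
qed

lemma dy_destr:
  assumes "destr \<Sigma> s us t" "dy \<Sigma> X s" "\<forall>u\<in>set us. dy \<Sigma> X u"
  shows "dy \<Sigma> X t"
proof -
  obtain \<pi> where "proof_from \<Sigma> X \<pi>" "concl \<pi> = s"
    using assms(2) unfolding dy_def by blast
  moreover from dy_list[OF assms(3)] obtain \<pi>s
    where "\<forall>\<pi>\<in>set \<pi>s. proof_from \<Sigma> X \<pi>" "map concl \<pi>s = us" .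
  ultimately show ?thesis
    using assms(1) unfolding dy_def by (intro HOL.exI[of _ "Destr t \<pi> \<pi>s"]) auto
qed

text \<open>Substitution and cut in one: each axiom leaf \<open>s\<close> is replaced by a
  derivation of \<open>tsub \<sigma> s\<close>, and the rules below the leaves are stable under
  \<open>\<sigma>\<close>.\<close>

lemma dy_tsub:
  assumes "dy \<Sigma> X t" and "\<forall>s\<in>X. dy \<Sigma> Y (tsub \<sigma> s)" and wf: "\<forall>d\<in>drules \<Sigma>. wf_drule \<Sigma> d"
  shows "dy \<Sigma> Y (tsub \<sigma> t)"
proof -
  have "dy \<Sigma> Y (tsub \<sigma> (concl \<pi>))" if "proof_from \<Sigma> X \<pi>" for \<pi>
    using that
  proof (induction \<pi>)
    case (Axiom s)
    then show ?case using assms(2) by simp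
  next
    case (Constr f \<pi>s)
    then show ?case by (auto intro!: dy_constr)
  next
    case (Destr s \<pi> \<pi>s)
    then have "destr \<Sigma> (tsub \<sigma> (concl \<pi>)) (map (tsub \<sigma>) (map concl \<pi>s)) (tsub \<sigma> s)"
      by (intro destr_tsub wf) simp
    then show ?case
      unfolding concl.simps by (rule dy_destr) (use Destr in auto)
  qed
  then show ?thesis
    using assms(1) unfolding dy_def by blast
qed

lemma dy_mono:
  assumes "dy \<Sigma> X t" "X \<subseteq> Y" shows "dy \<Sigma> Y t"
proof -
  have "proof_from \<Sigma> X \<pi> \<Longrightarrow> proof_from \<Sigma> Y \<pi>" for \<pi>
    by (induction \<pi>) (use assms(2) in auto)
  then show ?thesis
    using assms(1) unfolding dy_def by blast
qed

text \<open>A destructor returns an argument of its major premise, the index being in range by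
  \<open>wf_drule\<close>; constructors only collect variables.\<close>

lemma dy_vars:
  assumes "dy \<Sigma> X t" and wf: "\<forall>d\<in>drules \<Sigma>. wf_drule \<Sigma> d"
  shows "vars t \<subseteq> (\<Union>s\<in>X. vars s)"
proof -
  have "vars (concl \<pi>) \<subseteq> (\<Union>s\<in>X. vars s)" if "proof_from \<Sigma> X \<pi>" for \<pi>
    using that
  proof (induction \<pi>)
    case (Destr s \<pi> \<pi>s)
    then obtain f ps qs i \<theta> where d: "DRule f ps qs i \<in> drules \<Sigma>"
      "concl \<pi> = Fn f (map (inst \<theta>) ps)" "s = inst \<theta> (ps ! i)"
      unfolding proof_from.simps destr_def by blast
    have "i < length ps"
      using wf d(1) by fastforce
    then have "vars s \<subseteq> vars (concl \<pi>)"
      using d(2,3) by force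
    then show ?case using Destr by auto
  qed fastforce+
  then show ?thesis
    using assms(1) unfolding dy_def by blast
qed


section \<open>Abstractable variables\<close>

definition abstr :: "('f, 'v) signature \<Rightarrow> ('f, 'n, 'v) trm set \<Rightarrow> 'v \<Rightarrow> ('f, 'n, 'v) trm \<Rightarrow> bool" where
  "abstr \<Sigma> S x t \<longleftrightarrow> pos_of (Var x) t \<subseteq> abs_pos \<Sigma> S t"

lemma Nil_pos [simp]: "[] \<in> pos t"
  by (cases t) auto

lemma Qpos_Nil [simp]: "Qpos t [] = {[]}"
  by (auto simp: Qpos_def)

text \<open>The prefix \<open>[]\<close> of \<open>i # p\<close> contributes all children of the
  root, siblings of \<open>i\<close> included; the longer prefixes start with \<open>i\<close> and
  live in \<open>ts ! i\<close>.\<close>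

lemma Qpos_Cons:
  assumes "i < length ts"
  shows "Qpos (Fn f ts) (i # p) =
    insert [] ((\<lambda>j. [j]) ` {..<length ts} \<union> (#) i ` Qpos (ts ! i) p)" (is "?L = ?R")
proof
  show "?L \<subseteq> ?R"
  proof
    fix r assume "r \<in> ?L"
    then consider "r = []" | q j where "r = q @ [j]" "q @ [j] \<in> pos (Fn f ts)" "strict_prefix q (i # p)"
      unfolding Qpos_def by blast
    then show "r \<in> ?R"
    proof cases
      case 2
      then show ?thesis
        by (cases q) (auto simp: Qpos_def)
    qed simp
  qed
  have "[j] \<in> ?L" if "j < length ts" for j
    using that unfolding Qpos_def by (auto intro!: HOL.exI[of _ "[]"] image_eqI[of _ _ "[]"])
  moreover have "i # r \<in> ?L" if "r \<in> Qpos (ts ! i) p" for r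
  proof (cases "r = []")
    case True
    then show ?thesis using calculation assms by simp
  next
    case False
    with that obtain q j where "r = q @ [j]" "q @ [j] \<in> pos (ts ! i)" "strict_prefix q p"
      unfolding Qpos_def by blast
    then show ?thesis
      using assms unfolding Qpos_def by (auto intro!: HOL.exI[of _ "i # q"])
  qed
  moreover have "[] \<in> ?L"
    by (simp add: Qpos_def)
  ultimately show "?R \<subseteq> ?L"
    by blast
qed

lemma Nil_abs_pos: "[] \<in> abs_pos \<Sigma> S t \<longleftrightarrow> dy \<Sigma> S t"
  by (simp add: abs_pos_def)

lemma Cons_abs_pos: "i # p \<in> abs_pos \<Sigma> S (Fn f ts) \<longleftrightarrow>
    i < length ts \<and> dy \<Sigma> S (Fn f ts) \<and> (\<forall>u\<in>set ts. dy \<Sigma> S u) \<and> p \<in> abs_pos \<Sigma> S (ts ! i)"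
proof (cases "i < length ts")
  case True
  have *: "(\<forall>u\<in>set ts. dy \<Sigma> S u) \<longleftrightarrow> (\<forall>j<length ts. dy \<Sigma> S (ts ! j))"
    by (metis in_set_conv_nth)
  show ?thesis
    using True by (simp add: abs_pos_def Qpos_Cons[OF True] ball_Un *) blast
qed (auto simp: abs_pos_def)

lemma pos_of_Fn: "pos_of (Var x) (Fn f ts) = {i # p | i p. i < length ts \<and> p \<in> pos_of (Var x) (ts ! i)}"
  by (auto simp: pos_of_def)

lemma pos_of_Var_iff: "(\<exists>p. p \<in> pos_of (Var x) t) \<longleftrightarrow> x \<in> vars t"
proof (induction t)
  case (Fn f ts)
  have "(\<exists>p. p \<in> pos_of (Var x) (Fn f ts)) \<longleftrightarrow> (\<exists>i<length ts. \<exists>p. p \<in> pos_of (Var x) (ts ! i))"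
    unfolding pos_of_Fn by blast
  also have "\<dots> \<longleftrightarrow> x \<in> vars (Fn f ts)"
  proof -
    have "\<forall>i<length ts. (\<exists>p. p \<in> pos_of (Var x) (ts ! i)) \<longleftrightarrow> x \<in> vars (ts ! i)"
      using Fn.IH by simp
    then show ?thesis
      by (simp add: Bex_def in_set_conv_nth) blast
  qed
  finally show ?case .
qed (auto simp: pos_of_def)

lemma abstr_Var: "abstr \<Sigma> S x (Var y) \<longleftrightarrow> (y = x \<longrightarrow> dy \<Sigma> S (Var x))"
  by (auto simp: abstr_def pos_of_def abs_pos_def)

text \<open>This recursion replaces reasoning about positions in terms. Once \<open>x\<close>
  occurs, even the arguments without \<open>x\<close> must be derivable, because \<open>Qpos\<close>
  contains the siblings along the path.\<close>

lemma abstr_Fn: "abstr \<Sigma> S x (Fn f ts) \<longleftrightarrow>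
    (x \<in> vars (Fn f ts) \<longrightarrow> dy \<Sigma> S (Fn f ts) \<and> (\<forall>u\<in>set ts. dy \<Sigma> S u \<and> abstr \<Sigma> S x u))"
proof -
  note * = pos_of_Fn[of x f ts]
  show ?thesis
  proof (cases "x \<in> vars (Fn f ts)")
    case True
    then obtain i p where ip: "i < length ts" "p \<in> pos_of (Var x) (ts ! i)"
      using pos_of_Var_iff[of x "Fn f ts"] * by blast
    show ?thesis
    proof
      assume "abstr \<Sigma> S x (Fn f ts)"
      then have *: "j < length ts \<Longrightarrow> q \<in> pos_of (Var x) (ts ! j) \<Longrightarrow> j # q \<in> abs_pos \<Sigma> S (Fn f ts)" for j q
        unfolding abstr_def pos_of_Fn by blast
      then have "abstr \<Sigma> S x (ts ! j)" if "j < length ts" for j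
        using that unfolding abstr_def by (auto simp: Cons_abs_pos)
      then show "x \<in> vars (Fn f ts) \<longrightarrow>
          dy \<Sigma> S (Fn f ts) \<and> (\<forall>u\<in>set ts. dy \<Sigma> S u \<and> abstr \<Sigma> S x u)"
        using *[OF ip] by (auto simp: Cons_abs_pos in_set_conv_nth)
    next
      assume *: "x \<in> vars (Fn f ts) \<longrightarrow>
          dy \<Sigma> S (Fn f ts) \<and> (\<forall>u\<in>set ts. dy \<Sigma> S u \<and> abstr \<Sigma> S x u)"
      then have dy: "dy \<Sigma> S (Fn f ts)" "\<forall>u\<in>set ts. dy \<Sigma> S u"
        using True by blast+
      have sub: "pos_of (Var x) (ts ! j) \<subseteq> abs_pos \<Sigma> S (ts ! j)" if "j < length ts" for j
        using * True that by (simp add: abstr_def)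
      show "abstr \<Sigma> S x (Fn f ts)"
        unfolding abstr_def pos_of_Fn using dy subsetD[OF sub] by (auto simp: Cons_abs_pos)
    qed
  next
    case False
    then have "pos_of (Var x) (Fn f ts) = {}"
      using pos_of_Var_iff[of x "Fn f ts"] by blast
    then show ?thesis using False by (simp add: abstr_def)
  qed
qed

lemma abstr_notin: "x \<notin> vars t \<Longrightarrow> abstr \<Sigma> S x t"
  using pos_of_Var_iff[of x t] by (auto simp: abstr_def)

lemma abstr_st: "abstr \<Sigma> S x t \<Longrightarrow> u \<in> st t \<Longrightarrow> abstr \<Sigma> S x u"
proof (induction t)
  case (Fn f ts)
  then show ?case
    by (cases "x \<in> vars (Fn f ts)") (auto simp: abstr_Fn intro: abstr_notin)
qed auto

lemma abstr_mono: "abstr \<Sigma> S x t \<Longrightarrow> S \<subseteq> S' \<Longrightarrow> abstr \<Sigma> S' x t"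
  by (induction t) (auto simp: abstr_Var abstr_Fn intro: dy_mono abstr_notin)

text \<open>The last two hypotheses make the occurrences of \<open>x\<close> in
  \<open>tsub \<sigma> t\<close> exactly those inherited from \<open>t\<close>; the terms that have
  to be derivable are then images of derivable ones.\<close>

lemma abstr_tsub:
  assumes "abstr \<Sigma> S x t" "\<forall>s\<in>S. dy \<Sigma> S' (tsub \<sigma> s)" "\<forall>d\<in>drules \<Sigma>. wf_drule \<Sigma> d"
    "\<sigma> x = Var x" "\<forall>w. w \<noteq> x \<longrightarrow> x \<notin> vars (\<sigma> w)"
  shows "abstr \<Sigma> S' x (tsub \<sigma> t)"
  using assms(1)
proof (induction t)
  case (Var y)
  then show ?case
    using assms(2-) dy_tsub[of \<Sigma> S "Var x" S' \<sigma>]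
    by (cases "y = x") (auto simp: abstr_Var intro: abstr_notin)
next
  case (Fn f ts)
  show ?case
  proof (cases "x \<in> vars (Fn f ts)")
    case True
    then have "dy \<Sigma> S' (tsub \<sigma> (Fn f ts))" "\<forall>u\<in>set ts. dy \<Sigma> S' (tsub \<sigma> u)"
      using Fn.prems assms(2,3) by (auto simp only: abstr_Fn intro: dy_tsub)
    then show ?thesis
      using True Fn by (auto simp: abstr_Fn)
  next
    case False
    then have "x \<notin> vars (tsub \<sigma> (Fn f ts))"
      using assms(5) by (force simp: vars_tsub)
    then show ?thesis by (rule abstr_notin)
  qed
qed (auto intro: abstr_notin)

text \<open>A subterm of \<open>t\<close> containing some \<open>y \<in> Y\<close> is derivable because \<open>y\<close> is abstractable;
  any other subterm is left unchanged by \<open>\<sigma>\<close>.\<close>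

lemma abstr_tsubD:
  assumes "abstr \<Sigma> S x (tsub \<sigma> t)" "\<forall>y\<in>Y. abstr \<Sigma> S y t"
    "\<forall>w\<in>vars t - Y. \<sigma> w = Var w" "x \<notin> Y"
  shows "abstr \<Sigma> S x t"
  using assms(1-3)
proof (induction t)
  case (Var y)
  then show ?case using assms(4) by (auto simp: abstr_Var)
next
  case (Fn f ts)
  show ?case
  proof (cases "x \<in> vars (Fn f ts)")
    case True
    then have x: "x \<in> vars (tsub \<sigma> (Fn f ts))"
      using Fn.prems(3) assms(4) by (force simp: vars_tsub)
    have dy: "dy \<Sigma> S v" if v: "v = Fn f ts \<or> v \<in> set ts" for v
    proof (cases "vars v \<inter> Y = {}")
      case True
      then have "\<And>w. w \<in> vars v \<Longrightarrow> \<sigma> w = Var w"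
        using Fn.prems(3) v by auto
      then have "tsub \<sigma> v = tsub Var v"
        by (rule tsub_cong)
      moreover have "dy \<Sigma> S (tsub \<sigma> v)"
        using Fn.prems(1) x v by (auto simp: abstr_Fn)
      ultimately show ?thesis by simp
    next
      case False
      then obtain y where "y \<in> vars v" "y \<in> Y" by blast
      then show ?thesis
        using Fn.prems(2) v by (auto simp: abstr_Fn)
    qed
    have "abstr \<Sigma> S x u" if u: "u \<in> set ts" for u
    proof (rule Fn.IH[OF u])
      show "abstr \<Sigma> S x (tsub \<sigma> u)"
        using Fn.prems(1) x u by (auto simp: abstr_Fn)
      show "\<forall>y\<in>Y. abstr \<Sigma> S y u"
        using Fn.prems(2) u by (fastforce simp: abstr_Fn intro: abstr_notin)
      show "\<forall>w\<in>vars u - Y. \<sigma> w = Var w"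
        using Fn.prems(3) u by auto
    qed
    then show ?thesis
      using dy by (auto simp: abstr_Fn)
  next
    case False
    then show ?thesis by (rule abstr_notin)
  qed
qed (auto intro: abstr_notin)

section \<open>Abstractability in assertions\<close>

definition abstr_assn ::
  "('f, 'v) signature \<Rightarrow> ('f, 'n, 'v) trm set \<Rightarrow> 'v \<Rightarrow> ('p, 'f, 'n, 'v) assn \<Rightarrow> bool" where
  "abstr_assn \<Sigma> S x \<alpha> \<longleftrightarrow> pos_of_assn \<Sigma> (Var x) \<alpha> \<subseteq> abs_pos_assn \<Sigma> S \<alpha>"

lemma pos_of_assn_simps:
  "pos_of_assn \<Sigma> (Var x) (Eq t u) = (#) 0 ` pos_of (Var x) t \<union> (#) 1 ` pos_of (Var x) u"
  "pos_of_assn \<Sigma> (Var x) (Pred P us) = {i # p | i p. i < length us \<and> p \<in> pos_of (Var x) (us ! i)}"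
  "pos_of_assn \<Sigma> (Var x) (Mem t ns) = (#) 0 ` pos_of (Var x) t"
  "pos_of_assn \<Sigma> (Var x) (Conj \<alpha> \<beta>) =
    (#) 0 ` pos_of_assn \<Sigma> (Var x) \<alpha> \<union> (#) 1 ` pos_of_assn \<Sigma> (Var x) \<beta>"
  "pos_of_assn \<Sigma> (Var x) (Ex z \<alpha>) = (#) 0 ` pos_of_assn \<Sigma> (Var x) \<alpha>"
  "pos_of_assn \<Sigma> (Var x) (Says k \<alpha>) =
    (\<lambda>p. 0 # 0 # p) ` pos_of (Var x) k \<union> (#) 1 ` pos_of_assn \<Sigma> (Var x) \<alpha>"
  by (auto simp: pos_of_assn_def pos_of_def)

lemma pos_of_Nil: "x \<in> vars t \<Longrightarrow> pos_of (Var x) t \<subseteq> {[]} \<longleftrightarrow> t = Var x"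
  by (cases t) (use pos_of_Var_iff[of x t] in \<open>auto simp: pos_of_def\<close>)

text \<open>In \<open>Pred\<close> and \<open>Mem\<close> only the roots of arguments are
  abstractable, so an argument containing \<open>x\<close> must be \<open>x\<close>. In
  \<open>Says\<close> the abstractable \<open>[0]\<close> is the position of the term pk(k), whereas
  the key starts at \<open>[0, 0]\<close>, so \<open>x\<close> cannot occur in
  \<open>k\<close>.\<close>

lemma abstr_assn_simps:
  "abstr_assn \<Sigma> S x (Eq t u) \<longleftrightarrow> abstr \<Sigma> S x t \<and> abstr \<Sigma> S x u"
  "abstr_assn \<Sigma> S x (Pred P us) \<longleftrightarrow> (\<forall>u\<in>set us. x \<in> vars u \<longrightarrow> u = Var x \<and> dy \<Sigma> S u)"
  "abstr_assn \<Sigma> S x (Mem t ns) \<longleftrightarrow> (x \<in> vars t \<longrightarrow> t = Var x)"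
  "abstr_assn \<Sigma> S x (Conj \<alpha> \<beta>) \<longleftrightarrow> abstr_assn \<Sigma> S x \<alpha> \<and> abstr_assn \<Sigma> S x \<beta>"
  "abstr_assn \<Sigma> S x (Ex z \<alpha>) \<longleftrightarrow> abstr_assn \<Sigma> (S \<union> {Var z}) x \<alpha>"
  "abstr_assn \<Sigma> S x (Says k \<alpha>) \<longleftrightarrow> x \<notin> vars k \<and> abstr_assn \<Sigma> S x \<alpha>"
proof -
  show "abstr_assn \<Sigma> S x (Pred P us) \<longleftrightarrow> (\<forall>u\<in>set us. x \<in> vars u \<longrightarrow> u = Var x \<and> dy \<Sigma> S u)"
  proof -
    have "abstr_assn \<Sigma> S x (Pred P us) \<longleftrightarrow>
      (\<forall>i<length us. \<forall>p. p \<in> pos_of (Var x) (us ! i) \<longrightarrow> p = [] \<and> dy \<Sigma> S (us ! i))"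
      unfolding abstr_assn_def pos_of_assn_simps by auto
    also have "\<dots> \<longleftrightarrow> (\<forall>u\<in>set us. \<forall>p. p \<in> pos_of (Var x) u \<longrightarrow> p = [] \<and> dy \<Sigma> S u)"
      by (simp add: all_set_conv_all_nth)
    also have "\<dots> \<longleftrightarrow> (\<forall>u\<in>set us. x \<in> vars u \<longrightarrow> u = Var x \<and> dy \<Sigma> S u)"
    proof (rule ball_cong[OF refl])
      fix u
      show "(\<forall>p. p \<in> pos_of (Var x) u \<longrightarrow> p = [] \<and> dy \<Sigma> S u) \<longleftrightarrow>
        (x \<in> vars u \<longrightarrow> u = Var x \<and> dy \<Sigma> S u)"
        using pos_of_Var_iff[of x u] pos_of_Nil[of x u] by blast
    qed
    finally show ?thesis .
  qed
  show "abstr_assn \<Sigma> S x (Mem t ns) \<longleftrightarrow> (x \<in> vars t \<longrightarrow> t = Var x)"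
    using pos_of_Var_iff[of x t] pos_of_Nil[of x t]
    unfolding abstr_assn_def pos_of_assn_simps by auto
  show "abstr_assn \<Sigma> S x (Says k \<alpha>) \<longleftrightarrow> x \<notin> vars k \<and> abstr_assn \<Sigma> S x \<alpha>"
    using pos_of_Var_iff[of x k]
    unfolding abstr_assn_def pos_of_assn_simps by auto
qed (auto simp: abstr_assn_def abstr_def pos_of_assn_simps)

lemma abstr_assn_mono: "abstr_assn \<Sigma> S x \<alpha> \<Longrightarrow> S \<subseteq> S' \<Longrightarrow> abstr_assn \<Sigma> S' x \<alpha>"
proof (induction \<alpha> arbitrary: S S')
  case (Ex z \<alpha>)
  then show ?case
    unfolding abstr_assn_simps by (meson Un_mono order_refl)
qed (auto simp: abstr_assn_simps intro: abstr_mono dy_mono)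

lemma abstr_assn_notin: "x \<notin> fv \<alpha> \<union> bv \<alpha> \<Longrightarrow> abstr_assn \<Sigma> S x \<alpha>"
  by (induction \<alpha> arbitrary: S) (auto simp: abstr_assn_simps intro: abstr_notin)

text \<open>This yields condition (d). \<open>Mem\<close> grants its root without any derivability,
  so \<open>Var x\<close> in \<open>S\<close> has to supply it; with all binders in
  \<open>S\<close>, the variables that \<open>Ex\<close> adds are absorbed.\<close>

lemma abstr_assn_st:
  "abstr_assn \<Sigma> S x \<alpha> \<Longrightarrow> Var x \<in> S \<Longrightarrow> Var ` bv \<alpha> \<subseteq> S \<Longrightarrow> t \<in> st_assn \<Sigma> \<alpha> \<Longrightarrow> abstr \<Sigma> S x t"
proof (induction \<alpha>)
  case (Pred P us)
  then obtain u where u: "u \<in> set us" "t \<in> st u" by auto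
  have "abstr \<Sigma> S x u"
    using Pred u by (cases "x \<in> vars u") (auto simp: abstr_assn_simps abstr_Var intro: abstr_notin)
  then show ?case using u by (blast intro: abstr_st)
next
  case (Mem u ns)
  have "abstr \<Sigma> S x u"
    using Mem by (cases "x \<in> vars u") (auto simp: abstr_assn_simps abstr_Var dy_ax intro: abstr_notin)
  then show ?case using Mem by (auto intro: abstr_st abstr_notin)
next
  case (Ex z \<alpha>)
  then have "S \<union> {Var z} = S" by auto
  then show ?case using Ex by (auto simp: abstr_assn_simps)
next
  case (Says k \<alpha>)
  then show ?case by (auto simp: abstr_assn_simps intro: abstr_st[OF abstr_notin] abstr_notin)
qed (auto simp: abstr_assn_simps intro: abstr_st)

section \<open>Substitution in assertions\<close>

text \<open>Binders are never renamed, so values can be captured; lemmas sensitive to this assume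
  that the values avoid \<open>bv \<alpha>\<close>.\<close>

fun asub :: "('v \<Rightarrow> ('f, 'n, 'v) trm) \<Rightarrow> ('p, 'f, 'n, 'v) assn \<Rightarrow> ('p, 'f, 'n, 'v) assn" where
  "asub \<sigma> (Eq t u) = Eq (tsub \<sigma> t) (tsub \<sigma> u)"
| "asub \<sigma> (Pred P us) = Pred P (map (tsub \<sigma>) us)"
| "asub \<sigma> (Mem t ns) = Mem (tsub \<sigma> t) ns"
| "asub \<sigma> (Conj \<alpha> \<beta>) = Conj (asub \<sigma> \<alpha>) (asub \<sigma> \<beta>)"
| "asub \<sigma> (Ex x \<alpha>) = Ex x (asub (\<sigma>(x := Var x)) \<alpha>)"
| "asub \<sigma> (Says k \<alpha>) = Says (tsub \<sigma> k) (asub \<sigma> \<alpha>)"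

lemma asub_cong: "(\<And>x. x \<in> fv \<alpha> \<Longrightarrow> \<sigma> x = \<tau> x) \<Longrightarrow> asub \<sigma> \<alpha> = asub \<tau> \<alpha>"
proof (induction \<alpha> arbitrary: \<sigma> \<tau>)
  case (Conj \<alpha> \<beta>)
  have "asub \<sigma> \<alpha> = asub \<tau> \<alpha>" "asub \<sigma> \<beta> = asub \<tau> \<beta>"
    by (rule Conj.IH, simp add: Conj.prems)+
  then show ?case by simp
next
  case (Ex x \<alpha>)
  have "asub (\<sigma>(x := Var x)) \<alpha> = asub (\<tau>(x := Var x)) \<alpha>"
    by (rule Ex.IH) (simp add: Ex.prems)
  then show ?case by simp
next
  case (Says k \<alpha>)
  have "asub \<sigma> \<alpha> = asub \<tau> \<alpha>"
    by (rule Says.IH) (simp add: Says.prems)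
  moreover have "tsub \<sigma> k = tsub \<tau> k"
    by (rule tsub_cong) (simp add: Says.prems)
  ultimately show ?case by simp
next
  case (Eq t u)
  have "tsub \<sigma> t = tsub \<tau> t" "tsub \<sigma> u = tsub \<tau> u"
    by (rule tsub_cong, simp add: Eq.prems)+
  then show ?case by simp
next
  case (Pred P us)
  have "tsub \<sigma> u = tsub \<tau> u" if "u \<in> set us" for u
    by (rule tsub_cong) (use Pred.prems that in auto)
  then show ?case by simp
next
  case (Mem t ns)
  have "tsub \<sigma> t = tsub \<tau> t"
    by (rule tsub_cong) (simp add: Mem.prems)
  then show ?case by simp
qed

lemma asub_Var [simp]: "asub Var \<alpha> = \<alpha>"
  by (induction \<alpha>) (auto intro: map_idI)

lemma bv_asub [simp]: "bv (asub \<sigma> \<alpha>) = bv \<alpha>"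
  by (induction \<alpha> arbitrary: \<sigma>) auto

lemma distinct_bv_asub [simp]: "distinct_bv (asub \<sigma> \<alpha>) = distinct_bv \<alpha>"
  by (induction \<alpha> arbitrary: \<sigma>) auto

lemma fv_asub: "fv (asub \<sigma> \<alpha>) \<subseteq> (\<Union>x\<in>fv \<alpha>. vars (\<sigma> x))"
proof (induction \<alpha> arbitrary: \<sigma>)
  case (Ex x \<alpha>)
  have "fv (asub (\<sigma>(x := Var x)) \<alpha>) \<subseteq> (\<Union>y\<in>fv \<alpha>. vars ((\<sigma>(x := Var x)) y))"
    by (rule Ex.IH)
  then show ?case by (auto split: if_splits)
next
  case (Conj \<alpha> \<beta>)
  then show ?case using Conj.IH[of \<sigma>] by (simp add: UN_Un) blast
next
  case (Says k \<alpha>)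
  then show ?case using Says.IH[of \<sigma>] by (simp add: UN_Un vars_tsub) blast
qed (auto simp: vars_tsub)

text \<open>Only \<open>\<tau>\<close> must avoid capture: \<open>\<sigma>\<close> is captured alike
  on both sides. \<open>distinct_bv\<close> preserves the hypothesis under a binder
  \<open>z\<close>, where \<open>\<tau>\<close> is reset to map \<open>z\<close> to itself.\<close>

lemma asub_asub:
  "\<forall>x\<in>fv \<alpha>. vars (\<tau> x) \<inter> bv \<alpha> = {} \<Longrightarrow> distinct_bv \<alpha> \<Longrightarrow>
    asub \<sigma> (asub \<tau> \<alpha>) = asub (\<lambda>x. tsub \<sigma> (\<tau> x)) \<alpha>"
proof (induction \<alpha> arbitrary: \<sigma> \<tau>)
  case (Ex z \<alpha>)
  have "asub (\<sigma>(z := Var z)) (asub (\<tau>(z := Var z)) \<alpha>) =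
    asub (\<lambda>x. tsub (\<sigma>(z := Var z)) ((\<tau>(z := Var z)) x)) \<alpha>"
    using Ex.prems by (intro Ex.IH) auto
  also have "\<dots> = asub ((\<lambda>x. tsub \<sigma> (\<tau> x))(z := Var z)) \<alpha>"
    using Ex.prems by (intro asub_cong) (auto intro!: tsub_cong)
  finally show ?case by simp
next
  case (Conj \<alpha> \<beta>)
  have "asub \<sigma> (asub \<tau> \<alpha>) = asub (\<lambda>x. tsub \<sigma> (\<tau> x)) \<alpha>"
    using Conj.prems by (intro Conj.IH) auto
  moreover have "asub \<sigma> (asub \<tau> \<beta>) = asub (\<lambda>x. tsub \<sigma> (\<tau> x)) \<beta>"
    using Conj.prems by (intro Conj.IH) auto
  ultimately show ?case by simp
qed (auto simp: tsub_tsub)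

lemma subst_tsub: "subst \<mu> t = tsub (\<lambda>x. case \<mu> x of None \<Rightarrow> Var x | Some t \<Rightarrow> t) t"
  by (induction t) auto

lemma subst_assn_asub:
  "subst_assn \<mu> \<alpha> = asub (\<lambda>x. case \<mu> x of None \<Rightarrow> Var x | Some t \<Rightarrow> t) \<alpha>"
proof (induction \<alpha> arbitrary: \<mu>)
  case (Ex x \<alpha>)
  then show ?case by (auto intro!: asub_cong)
qed (auto simp: subst_tsub fun_eq_iff)

text \<open>\<open>P\<close> is determined only on the positions of \<open>s\<close>, so that the
  hypothesis passes to the slices \<open>{p. i # p \<in> P}\<close> met in the recursion.\<close>

lemma replace_tsub:
  assumes "\<rho> x = t" "\<And>w. w \<noteq> x \<Longrightarrow> \<rho> w = Var w"
    and "\<And>p. p \<in> pos s \<Longrightarrow> p \<in> P \<longleftrightarrow> subterm_at s p = Var x"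
  shows "replace s P t = tsub \<rho> s"
  using assms(3)
proof (induction s arbitrary: P)
  case (Fn f ts)
  have "replace (ts ! i) {p. i # p \<in> P} t = tsub \<rho> (ts ! i)" if "i < length ts" for i
  proof (rule Fn.IH)
    show "ts ! i \<in> set ts" using that by simp
    fix p assume "p \<in> pos (ts ! i)"
    then have "i # p \<in> pos (Fn f ts)" using that by auto
    from Fn.prems[OF this] show "p \<in> {p. i # p \<in> P} \<longleftrightarrow> subterm_at (ts ! i) p = Var x"
      by simp
  qed
  then have "map (\<lambda>i. replace (ts ! i) {p. i # p \<in> P} t) [0..<length ts] = map (tsub \<rho>) ts"
    by (intro nth_equalityI) auto
  moreover have "[] \<notin> P"
    using Fn.prems[of "[]"] by simp
  ultimately show ?case by simp
qed (use assms(1,2) in auto)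

text \<open>\<open>x\<close> must not be bound in \<open>\<alpha>\<close>: replacement by position
  also reaches below a binder of \<open>x\<close>, where \<open>asub\<close> stops.\<close>

lemma replace_assn_asub:
  assumes "\<rho> x = t" "\<And>w. w \<noteq> x \<Longrightarrow> \<rho> w = Var w"
    and "\<And>p. p \<in> pos_assn \<Sigma> \<alpha> \<Longrightarrow> p \<in> P \<longleftrightarrow> subterm_at_assn \<Sigma> \<alpha> p = Var x" "x \<notin> bv \<alpha>"
  shows "replace_assn \<alpha> P t = asub \<rho> \<alpha>"
  using assms(3,4)
proof (induction \<alpha> arbitrary: P)
  case (Eq u v)
  show ?case
    using Eq.prems(1)[of "0 # _"] Eq.prems(1)[of "1 # _"] by (auto intro!: replace_tsub[where x = x] assms)
next
  case (Pred R us)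
  have "replace (us ! i) {p. i # p \<in> P} t = tsub \<rho> (us ! i)" if "i < length us" for i
    using Pred.prems(1)[of "i # _"] that by (intro replace_tsub[where x = x] assms) auto
  then have "map (\<lambda>i. replace (us ! i) {p. i # p \<in> P} t) [0..<length us] = map (tsub \<rho>) us"
    by (intro nth_equalityI) auto
  then show ?case by simp
next
  case (Mem u ns)
  show ?case
    using Mem.prems(1)[of "0 # _"] by (auto intro!: replace_tsub[where x = x] assms)
next
  case (Conj \<alpha> \<beta>)
  show ?case
    using Conj.prems(1)[of "0 # _"] Conj.prems(1)[of "1 # _"] Conj.prems(2)
    by (auto intro!: Conj.IH)
next
  case (Ex z \<alpha>)
  have "\<rho>(z := Var z) = \<rho>"
    using Ex.prems(2) assms(2) by auto
  then show ?case
    using Ex.prems(1)[of "0 # _"] Ex.prems(2) by (auto intro!: Ex.IH)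
next
  case (Says k \<alpha>)
  show ?case
    using Says.prems(1)[of "0 # 0 # _"] Says.prems(1)[of "1 # _"] Says.prems(2)
    by (auto intro!: Says.IH replace_tsub[where x = x] assms)
qed

lemma replace_pos_of_assn:
  "x \<notin> bv \<alpha> \<Longrightarrow> replace_assn \<alpha> (pos_of_assn \<Sigma> (Var x) \<alpha>) t = asub (Var(x := t)) \<alpha>"
  by (rule replace_assn_asub[where x = x]) (auto simp: pos_of_assn_def)

section \<open>Transfer of abstractability between an assertion and its instances\<close>

lemma vars_tsub_iff:
  "\<sigma> x = Var x \<Longrightarrow> \<forall>w. w \<noteq> x \<longrightarrow> x \<notin> vars (\<sigma> w) \<Longrightarrow> x \<in> vars (tsub \<sigma> t) \<longleftrightarrow> x \<in> vars t"
  unfolding vars_tsub by (metis UN_iff singletonI vars.simps(1))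

text \<open>Under a binder \<open>z\<close> the substitution is reset at \<open>z\<close>, which
  must not disturb \<open>S\<close>. A variable in \<open>S\<close> may coincide with
  \<open>z\<close>, but is then mapped to the new axiom \<open>Var z\<close>; compound terms of
  \<open>S\<close> come from \<open>S0\<close>, which avoids all binders.\<close>

lemma abstr_assn_asub:
  assumes "abstr_assn \<Sigma> S x \<alpha>" "\<forall>s\<in>S. dy \<Sigma> S' (tsub \<sigma> s)" "\<forall>d\<in>drules \<Sigma>. wf_drule \<Sigma> d"
    and "\<sigma> x = Var x" "\<forall>w. w \<noteq> x \<longrightarrow> x \<notin> vars (\<sigma> w)"
    and "S \<subseteq> S0 \<union> range Var" "(\<Union>s\<in>S0. vars s) \<inter> bv \<alpha> = {}" "x \<notin> bv \<alpha>"
  shows "abstr_assn \<Sigma> S' x (asub \<sigma> \<alpha>)"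
  using assms(1,2,4-)
proof (induction \<alpha> arbitrary: S S' \<sigma>)
  case (Ex z \<alpha>)
  let ?\<tau> = "\<sigma>(z := Var z)"
  have "abstr_assn \<Sigma> (S' \<union> {Var z}) x (asub ?\<tau> \<alpha>)"
  proof (rule Ex.IH)
    show "abstr_assn \<Sigma> (S \<union> {Var z}) x \<alpha>"
      using Ex.prems(1) by (simp add: abstr_assn_simps)
    show "\<forall>s\<in>S \<union> {Var z}. dy \<Sigma> (S' \<union> {Var z}) (tsub ?\<tau> s)"
    proof
      fix s assume s: "s \<in> S \<union> {Var z}"
      show "dy \<Sigma> (S' \<union> {Var z}) (tsub ?\<tau> s)"
      proof (cases "s = Var z")
        case False
        then have "s \<in> S0 \<or> (\<exists>w. s = Var w)"
          using s Ex.prems(5) by blast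
        then have "z \<notin> vars s"
          using False Ex.prems(6) by auto
        then have "tsub ?\<tau> s = tsub \<sigma> s"
          by (intro tsub_cong) auto
        then show ?thesis
          using False s Ex.prems(2) by (auto intro: dy_mono)
      qed (simp add: dy_ax)
    qed
  qed (use Ex.prems in auto)
  then show ?case by (simp add: abstr_assn_simps)
next
  case (Eq t u)
  then show ?case
    using assms(3) by (auto simp: abstr_assn_simps intro: abstr_tsub)
next
  case (Pred P us)
  show ?case
    unfolding asub.simps abstr_assn_simps
  proof (intro ballI impI)
    fix u' assume "u' \<in> set (map (tsub \<sigma>) us)" "x \<in> vars u'"
    then obtain u where u: "u \<in> set us" "u' = tsub \<sigma> u" "x \<in> vars u"
      using vars_tsub_iff[OF Pred.prems(3,4)] by auto
    then have "u = Var x" "dy \<Sigma> S u"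
      using Pred.prems(1) by (auto simp: abstr_assn_simps)
    then show "u' = Var x \<and> dy \<Sigma> S' u'"
      using u(2) Pred.prems(2,3) assms(3) dy_tsub by fastforce
  qed
next
  case (Mem t ns)
  then show ?case
    using vars_tsub_iff[OF Mem.prems(3,4)] by (auto simp: abstr_assn_simps)
next
  case (Conj \<alpha> \<beta>)
  have "abstr_assn \<Sigma> S' x (asub \<sigma> \<alpha>)"
    by (rule Conj.IH(1)[of S]) (use Conj.prems in \<open>auto simp: abstr_assn_simps\<close>)
  moreover have "abstr_assn \<Sigma> S' x (asub \<sigma> \<beta>)"
    by (rule Conj.IH(2)[of S]) (use Conj.prems in \<open>auto simp: abstr_assn_simps\<close>)
  ultimately show ?case by (simp add: abstr_assn_simps)
next
  case (Says k \<alpha>)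
  have "abstr_assn \<Sigma> S' x (asub \<sigma> \<alpha>)"
    by (rule Says.IH[of S]) (use Says.prems in \<open>auto simp: abstr_assn_simps\<close>)
  then show ?case
    using Says.prems(1) vars_tsub_iff[OF Says.prems(3,4)] by (simp add: abstr_assn_simps)
qed

text \<open>\<open>Y\<close> holds the variables already instantiated. In \<open>Pred\<close> and
  \<open>Mem\<close> an argument meeting \<open>Y\<close> is itself a variable of \<open>Y\<close>,
  and a key avoids \<open>Y\<close>; so there \<open>x\<close> can occur only in parts that
  \<open>\<sigma>\<close> leaves unchanged. Equations reduce to the lemma on terms.\<close>

lemma abstr_assn_asubD:
  assumes "abstr_assn \<Sigma> S x (asub \<sigma> \<alpha>)" "\<forall>y\<in>Y. abstr_assn \<Sigma> S y \<alpha>"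
    "\<forall>w\<in>fv \<alpha> - Y. \<sigma> w = Var w" "x \<notin> Y" "Var x \<in> S" "Var ` bv \<alpha> \<subseteq> S" "bv \<alpha> \<inter> Y = {}"
  shows "abstr_assn \<Sigma> S x \<alpha>"
  using assms
proof (induction \<alpha> arbitrary: \<sigma>)
  case (Eq t u)
  then show ?case
    by (auto simp: abstr_assn_simps intro: abstr_tsubD[of _ _ _ \<sigma> _ Y])
next
  case (Pred P us)
  have "u = Var x" if u: "u \<in> set us" "x \<in> vars u" for u
  proof (cases "vars u \<inter> Y = {}")
    case True
    then have "tsub \<sigma> u = tsub Var u"
      using Pred.prems(3) u by (intro tsub_cong) auto
    then show ?thesis
      using Pred.prems(1) u by (auto simp: abstr_assn_simps)
  next
    case False
    then obtain y where "y \<in> Y" "u = Var y"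
      using Pred.prems(2) u by (auto simp: abstr_assn_simps)
    then show ?thesis using u by simp
  qed
  then show ?case
    using Pred.prems(5) by (auto simp: abstr_assn_simps dy_ax)
next
  case (Mem t ns)
  have "t = Var x" if u: "x \<in> vars t"
  proof (cases "vars t \<inter> Y = {}")
    case True
    then have "tsub \<sigma> t = tsub Var t"
      using Mem.prems(3) by (intro tsub_cong) auto
    then show ?thesis
      using Mem.prems(1) u by (auto simp: abstr_assn_simps)
  next
    case False
    then obtain y where "y \<in> Y" "t = Var y"
      using Mem.prems(2) by (auto simp: abstr_assn_simps)
    then show ?thesis using u by simp
  qed
  then show ?case
    by (simp add: abstr_assn_simps)
next
  case (Conj \<alpha> \<beta>)
  have "abstr_assn \<Sigma> S x \<alpha>"
    by (rule Conj.IH(1)[of \<sigma>]) (use Conj.prems in \<open>auto simp: abstr_assn_simps\<close>)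
  moreover have "abstr_assn \<Sigma> S x \<beta>"
    by (rule Conj.IH(2)[of \<sigma>]) (use Conj.prems in \<open>auto simp: abstr_assn_simps\<close>)
  ultimately show ?case by (simp add: abstr_assn_simps)
next
  case (Ex z \<alpha>)
  then have S: "S \<union> {Var z} = S" by auto
  have "abstr_assn \<Sigma> S x \<alpha>"
  proof (rule Ex.IH[of "\<sigma>(z := Var z)"])
    show "abstr_assn \<Sigma> S x (asub (\<sigma>(z := Var z)) \<alpha>)"
      using Ex.prems(1) S by (simp add: abstr_assn_simps del: fun_upd_apply)
    show "\<forall>y\<in>Y. abstr_assn \<Sigma> S y \<alpha>"
      using Ex.prems(2) S by (simp add: abstr_assn_simps)
  qed (use Ex.prems in auto)
  then show ?case using S by (simp add: abstr_assn_simps)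
next
  case (Says k \<alpha>)
  have "abstr_assn \<Sigma> S x \<alpha>"
    by (rule Says.IH[of \<sigma>]) (use Says.prems in \<open>auto simp: abstr_assn_simps\<close>)
  moreover have "tsub \<sigma> k = k"
    using tsub_cong[of k \<sigma> Var] Says.prems(2,3) by (auto simp: abstr_assn_simps)
  ultimately show ?case
    using Says.prems(1) by (auto simp: abstr_assn_simps)
qed

section \<open>Regularity and free variables of derivable assertions\<close>

lemma regularD:
  "regular (Conj \<alpha> \<beta>) \<Longrightarrow> regular \<alpha>"
  "regular (Conj \<alpha> \<beta>) \<Longrightarrow> regular \<beta>"
  "regular (Ex x \<alpha>) \<Longrightarrow> regular \<alpha>"
  "regular (Ex x \<alpha>) \<Longrightarrow> x \<notin> bv \<alpha>"
  "regular (Says k \<alpha>) \<Longrightarrow> regular \<alpha>"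
  by (auto simp: regular_def)

lemma regular_atom [simp]: "regular (Eq t u)" "regular (Pred P us)" "regular (Mem t ns)"
  by (auto simp: regular_def)

lemma fv_asub_fixed: "w \<in> fv \<alpha> \<Longrightarrow> \<sigma> w = Var w \<Longrightarrow> w \<in> fv (asub \<sigma> \<alpha>)"
proof (induction \<alpha> arbitrary: \<sigma>)
  case (Pred P us)
  then show ?case by (force simp: vars_tsub)
qed (auto simp: vars_tsub intro: rev_bexI)

lemma fv_asub_single: "fv (asub (Var(x := t)) \<alpha>) \<subseteq> (fv \<alpha> - {x}) \<union> vars t"
  using fv_asub[of "Var(x := t)" \<alpha>] by (auto split: if_splits)

text \<open>The introduction rules have regularity as a side condition. (\<exists>E) adds a
  hypothesis, \<open>\<alpha>\<close> with \<open>x\<close> replaced by \<open>y\<close>, which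
  stays regular because \<open>y\<close> is not bound in \<open>\<alpha>\<close>.\<close>

lemma derives_regular:
  "derives \<Sigma> R S A \<alpha> \<Longrightarrow> \<forall>\<beta>\<in>A. regular \<beta> \<Longrightarrow> regular \<alpha>"
proof (induction rule: derives.induct)
  case (exE P x \<alpha> S A y \<gamma>)
  have r: "regular (Ex x \<alpha>)"
    using exE by blast
  have "regular (asub (Var(x := Var y)) \<alpha>)"
    using r fv_asub_single[of x "Var y" \<alpha>] exE.hyps(5,6) unfolding regular_def by auto
  then show ?case
    using exE regularD(4)[OF r] by (auto simp: replace_pos_of_assn)
qed (auto dest: regularD)

text \<open>The side conditions of (\<exists>E) do not compare the eigenvariable with the free
  variables of the premise \<open>Ex x \<alpha>\<close>; this bound supplies that freshness.\<close>

lemma derives_fv: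
  assumes "derives \<Sigma> R S A \<alpha>" "\<forall>\<beta>\<in>A. regular \<beta>" and wf: "\<forall>d\<in>drules \<Sigma>. wf_drule \<Sigma> d"
  shows "fv \<alpha> \<subseteq> fv_seq S A"
  using assms(1,2)
proof (induction rule: derives.induct)
  case (ax \<alpha> A S)
  then show ?case by (auto simp: fv_seq_def)
next
  case (eq S t A)
  then show ?case using dy_vars[OF eq(2) wf] by (auto simp: fv_seq_def)
next
  case (cons ts f us S A)
  have "\<forall>u\<in>set ts. vars u \<subseteq> fv_seq S A" "\<forall>u\<in>set us. vars u \<subseteq> fv_seq S A"
    unfolding all_set_conv_all_nth using cons by auto
  then show ?case by auto
next
  case (trans ts k S A)
  have "vars (ts ! j) \<subseteq> fv_seq S A \<and> vars (ts ! Suc j) \<subseteq> fv_seq S A" if "j < k" for j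
    using trans that by simp
  from this[of 0] this[of "k - 1"] show ?case
    using trans(3) by simp
next
  case (proj S A f ts us i)
  have "ts ! i \<in> set ts" "us ! i \<in> set us"
    using proj(3-5) by simp_all
  moreover have "(\<Union>t\<in>set ts. vars t) \<subseteq> fv_seq S A" "(\<Union>t\<in>set us. vars t) \<subseteq> fv_seq S A"
    using proj.IH[OF proj.prems] by simp_all
  ultimately show ?case
    by (simp add: UN_subset_iff)
next
  case (exI P x \<alpha> S A t)
  then have "fv (asub (Var(x := t)) \<alpha>) \<subseteq> fv_seq S A"
    using regularD(4)[OF exI.hyps(7)] by (simp add: replace_pos_of_assn)
  moreover have "fv \<alpha> - {x} \<subseteq> fv (asub (Var(x := t)) \<alpha>)"
    by (auto intro!: fv_asub_fixed)
  ultimately show ?case by auto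
next
  case (exE P x \<alpha> S A y \<gamma>)
  have r: "regular (Ex x \<alpha>)"
    using derives_regular exE by blast
  have eq: "replace_assn \<alpha> P (Var y) = asub (Var(x := Var y)) \<alpha>"
    using exE.hyps(2) regularD(4)[OF r] by (simp add: replace_pos_of_assn)
  have "regular (asub (Var(x := Var y)) \<alpha>)"
    using r fv_asub_single[of x "Var y" \<alpha>] exE.hyps(6) unfolding regular_def by auto
  then have "fv \<gamma> \<subseteq> fv_seq (S \<union> {Var y}) (A \<union> {asub (Var(x := Var y)) \<alpha>})"
    using exE eq by auto
  moreover have "fv \<alpha> - {x} \<subseteq> fv_seq S A"
    using exE by simp
  ultimately show ?case
    using fv_asub_single[of x "Var y" \<alpha>] exE.hyps(5) unfolding fv_seq_def by auto
next
  case (say S A \<alpha> k)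
  then show ?case using dy_vars[OF say(3) wf] by (auto simp: fv_seq_def)
next
  case (int ls S A t ns)
  then show ?case by (cases ls) auto
qed auto


section \<open>Satisfaction in the kernel\<close>

text \<open>
  Abstractability is demanded only for formulas all of whose binders lie in \<open>D\<close>, which will be
  \<open>bv \<alpha>\<close> for the goal \<open>\<alpha>\<close>: it may fail for the quantifiers in \<open>A\<close>.
\<close>

fun sat :: "('f, 'v) signature \<Rightarrow> ('f, 'n, 'v) trm set \<Rightarrow> ('p, 'f, 'n, 'v) assn set \<Rightarrow> 'v set \<Rightarrow>
    ('v \<Rightarrow> ('f, 'n, 'v) trm) \<Rightarrow> ('p, 'f, 'n, 'v) assn \<Rightarrow> bool" where
  "sat \<Sigma> T E D \<sigma> (Eq t u) = derives_eq \<Sigma> T E (asub \<sigma> (Eq t u))"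
| "sat \<Sigma> T E D \<sigma> (Pred P us) = derives_eq \<Sigma> T E (asub \<sigma> (Pred P us))"
| "sat \<Sigma> T E D \<sigma> (Mem t ns) = derives_eq \<Sigma> T E (asub \<sigma> (Mem t ns))"
| "sat \<Sigma> T E D \<sigma> (Conj \<alpha> \<beta>) = (sat \<Sigma> T E D \<sigma> \<alpha> \<and> sat \<Sigma> T E D \<sigma> \<beta>)"
| "sat \<Sigma> T E D \<sigma> (Ex x \<alpha>) =
    ((insert x (bv \<alpha>) \<subseteq> D \<longrightarrow> abstr_assn \<Sigma> (T \<union> {Var x}) x (asub (\<sigma>(x := Var x)) \<alpha>)) \<and>
     (\<exists>t. dy \<Sigma> T t \<and> sat \<Sigma> T E D (\<sigma>(x := t)) \<alpha>))"
| "sat \<Sigma> T E D \<sigma> (Says k \<alpha>) =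
    (asub \<sigma> (Says k \<alpha>) \<in> E \<or> dy \<Sigma> T (tsub \<sigma> k) \<and> sat \<Sigma> T E D \<sigma> \<alpha>)"

lemma sat_cong: "(\<And>x. x \<in> fv \<alpha> \<Longrightarrow> \<sigma> x = \<tau> x) \<Longrightarrow> sat \<Sigma> T E D \<sigma> \<alpha> = sat \<Sigma> T E D \<tau> \<alpha>"
proof (induction \<alpha> arbitrary: \<sigma> \<tau>)
  case (Conj \<alpha> \<beta>)
  have "sat \<Sigma> T E D \<sigma> \<alpha> = sat \<Sigma> T E D \<tau> \<alpha>" "sat \<Sigma> T E D \<sigma> \<beta> = sat \<Sigma> T E D \<tau> \<beta>"
    by (rule Conj.IH, simp add: Conj.prems)+
  then show ?case by simp
next
  case (Ex x \<alpha>)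
  have "asub (\<sigma>(x := Var x)) \<alpha> = asub (\<tau>(x := Var x)) \<alpha>"
    by (rule asub_cong) (simp add: Ex.prems)
  moreover have "sat \<Sigma> T E D (\<sigma>(x := t)) \<alpha> = sat \<Sigma> T E D (\<tau>(x := t)) \<alpha>" for t
    by (rule Ex.IH) (simp add: Ex.prems)
  ultimately show ?case by simp
next
  case (Says k \<alpha>)
  have "sat \<Sigma> T E D \<sigma> \<alpha> = sat \<Sigma> T E D \<tau> \<alpha>"
    by (rule Says.IH) (simp add: Says.prems)
  moreover have "tsub \<sigma> k = tsub \<tau> k"
    by (rule tsub_cong) (simp add: Says.prems)
  moreover have "asub \<sigma> (Says k \<alpha>) = asub \<tau> (Says k \<alpha>)"
    by (rule asub_cong) (use Says.prems in auto)
  ultimately show ?case by simp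
next
  case (Eq t u)
  show ?case by (simp only: sat.simps asub_cong[OF Eq])
next
  case (Pred P us)
  show ?case by (simp only: sat.simps asub_cong[OF Pred])
next
  case (Mem t ns)
  show ?case by (simp only: sat.simps asub_cong[OF Mem])
qed

text \<open>Substitution in the formula is traded for composition of environments; this is how
  soundness absorbs the replacements in (\<exists>I) and (\<exists>E).\<close>

lemma sat_asub:
  "\<forall>x\<in>fv \<alpha>. vars (\<tau> x) \<inter> bv \<alpha> = {} \<Longrightarrow> distinct_bv \<alpha> \<Longrightarrow>
    sat \<Sigma> T E D \<sigma> (asub \<tau> \<alpha>) = sat \<Sigma> T E D (\<lambda>x. tsub \<sigma> (\<tau> x)) \<alpha>"
proof (induction \<alpha> arbitrary: \<sigma> \<tau>)
  case (Conj \<alpha> \<beta>)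
  have "sat \<Sigma> T E D \<sigma> (asub \<tau> \<alpha>) = sat \<Sigma> T E D (\<lambda>x. tsub \<sigma> (\<tau> x)) \<alpha>"
    "sat \<Sigma> T E D \<sigma> (asub \<tau> \<beta>) = sat \<Sigma> T E D (\<lambda>x. tsub \<sigma> (\<tau> x)) \<beta>"
    by (rule Conj.IH; use Conj.prems in auto)+
  then show ?case by simp
next
  case (Ex z \<alpha>)
  let ?\<tau> = "\<tau>(z := Var z)"
  have c: "\<forall>x\<in>fv \<alpha>. vars (?\<tau> x) \<inter> bv \<alpha> = {}" "distinct_bv \<alpha>"
    using Ex.prems by auto
  have upd: "tsub (\<sigma>(z := t)) (?\<tau> w) = ((\<lambda>x. tsub \<sigma> (\<tau> x))(z := t)) w" if "w \<in> fv \<alpha>" for w t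
    using Ex.prems(1) that by (auto intro!: tsub_cong)
  have "asub (\<sigma>(z := Var z)) (asub ?\<tau> \<alpha>) = asub ((\<lambda>x. tsub \<sigma> (\<tau> x))(z := Var z)) \<alpha>"
    unfolding asub_asub[OF c] using upd by (rule asub_cong)
  moreover have "sat \<Sigma> T E D (\<sigma>(z := t)) (asub ?\<tau> \<alpha>) = sat \<Sigma> T E D ((\<lambda>x. tsub \<sigma> (\<tau> x))(z := t)) \<alpha>" for t
    unfolding Ex.IH[OF c] using upd by (rule sat_cong)
  ultimately show ?case by simp
next
  case (Says k \<alpha>)
  have "sat \<Sigma> T E D \<sigma> (asub \<tau> \<alpha>) = sat \<Sigma> T E D (\<lambda>x. tsub \<sigma> (\<tau> x)) \<alpha>"
    by (rule Says.IH) (use Says.prems in auto)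
  moreover have "asub \<sigma> (asub \<tau> \<alpha>) = asub (\<lambda>x. tsub \<sigma> (\<tau> x)) \<alpha>"
    by (rule asub_asub) (use Says.prems in auto)
  ultimately show ?case by (simp add: tsub_tsub)
qed (simp_all add: tsub_tsub comp_def)

lemma sat_replace:
  assumes "regular (Ex x \<alpha>)" "vars t \<inter> bv \<alpha> = {}"
  shows "sat \<Sigma> T E D \<sigma> (replace_assn \<alpha> (pos_of_assn \<Sigma> (Var x) \<alpha>) t) =
    sat \<Sigma> T E D (\<sigma>(x := tsub \<sigma> t)) \<alpha>"
proof -
  have "sat \<Sigma> T E D \<sigma> (asub (Var(x := t)) \<alpha>) = sat \<Sigma> T E D (\<lambda>y. tsub \<sigma> ((Var(x := t)) y)) \<alpha>"
    by (rule sat_asub) (use assms in \<open>auto simp: regular_def\<close>)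
  also have "\<dots> = sat \<Sigma> T E D (\<sigma>(x := tsub \<sigma> t)) \<alpha>"
    by (rule sat_cong) simp
  finally show ?thesis
    using regularD(4)[OF assms(1)] by (simp add: replace_pos_of_assn)
qed

text \<open>In the kernel every bound variable is its own witness, since it is an axiom of
  \<open>T\<close>. Disjointness from \<open>D\<close> makes the demand for abstractability vacuous
  at the quantifiers.\<close>

lemma sat_at:
  "at \<alpha> \<subseteq> E \<Longrightarrow> Var ` bv \<alpha> \<subseteq> T \<Longrightarrow> bv \<alpha> \<inter> D = {} \<Longrightarrow> sat \<Sigma> T E D Var \<alpha>"
proof (induction \<alpha>)
  case (Ex x \<alpha>)
  then have "dy \<Sigma> T (Var x)" "sat \<Sigma> T E D (Var(x := Var x)) \<alpha>"
    by (auto simp: dy_ax fun_upd_idem)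
  then show ?case
    using Ex.prems by auto
next
  case (Pred P us)
  then show ?case by (auto intro: derives.ax simp: map_idI)
qed (auto intro: derives.ax)

lemma abs_pos_children:
  assumes "i < length ts" "[i] \<in> abs_pos \<Sigma> S (Fn f ts)"
  shows "dy \<Sigma> S (Fn f ts)" "\<forall>u\<in>set ts. dy \<Sigma> S u"
  using assms by (auto simp: Cons_abs_pos)

text \<open>\<open>S\<close> and \<open>A\<close> change along the derivation while \<open>T\<close>
  and \<open>E\<close> stay fixed. \<open>S0\<close> is the initial set of terms, to which
  (\<exists>E) adds only variables. The values of \<open>\<sigma>\<close> avoid \<open>D\<close>,
  and so do new witnesses because \<open>T\<close> does.\<close>

lemma derives_sat:
  fixes A E :: "('p, 'f, 'n, 'v) assn set"
  assumes "derives \<Sigma> R S A \<alpha>" and wf: "\<forall>d\<in>drules \<Sigma>. wf_drule \<Sigma> d"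
    and TD: "(\<Union>t\<in>T. vars t) \<inter> D = {}" and S0D: "(\<Union>s\<in>S0. vars s) \<inter> D = {}"
  shows "\<forall>\<beta>\<in>A. regular \<beta> \<Longrightarrow> \<forall>w. vars (\<sigma> w) \<inter> D = {} \<Longrightarrow> S \<subseteq> S0 \<union> range Var \<Longrightarrow>
    \<forall>s\<in>S. dy \<Sigma> T (tsub \<sigma> s) \<Longrightarrow> \<forall>\<beta>\<in>A. sat \<Sigma> T E D \<sigma> \<beta> \<Longrightarrow> sat \<Sigma> T E D \<sigma> \<alpha>"
  using assms(1)
proof (induction arbitrary: \<sigma> rule: derives.induct)
  case (eq S t A)
  then show ?case
    using dy_tsub[OF eq(2,6) wf] by (auto intro: derives.eq)
next
  case (cons ts f us S A)
  then have "\<forall>j<arity \<Sigma> f. derives_eq \<Sigma> T E (Eq (map (tsub \<sigma>) ts ! j) (map (tsub \<sigma>) us ! j))"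
    by simp
  then show ?case
    using cons(2,3) by (auto intro: derives.cons)
next
  case (sym S A t u)
  then show ?case by (auto intro: derives.sym)
next
  case (trans ts k S A)
  then have "\<forall>j<k. derives_eq \<Sigma> T E (Eq (map (tsub \<sigma>) ts ! j) (map (tsub \<sigma>) ts ! Suc j))"
    by simp
  then have "derives_eq \<Sigma> T E (Eq (map (tsub \<sigma>) ts ! 0) (map (tsub \<sigma>) ts ! k))"
    using trans(2,3) by (intro derives.trans) auto
  then show ?case
    using trans(2,3) by simp
next
  case (proj S A f ts us i)
  have "[i] \<in> abs_pos \<Sigma> S (Fn f ts)" "[i] \<in> abs_pos \<Sigma> S (Fn f us)"
    using proj(5,6) by auto
  then have dy: "dy \<Sigma> S (Fn f ts)" "\<forall>u\<in>set ts. dy \<Sigma> S u" "dy \<Sigma> S (Fn f us)" "\<forall>u\<in>set us. dy \<Sigma> S u"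
    using abs_pos_children proj(3-5) by metis+
  have "dy \<Sigma> T (tsub \<sigma> t)" if "dy \<Sigma> S t" for t
    using dy_tsub[OF that _ wf] proj.prems by blast
  then have dy': "dy \<Sigma> T (tsub \<sigma> (Fn f ts))" "\<forall>u\<in>set ts. dy \<Sigma> T (tsub \<sigma> u)"
    "dy \<Sigma> T (tsub \<sigma> (Fn f us))" "\<forall>u\<in>set us. dy \<Sigma> T (tsub \<sigma> u)"
    using dy by blast+
  have "derives_eq \<Sigma> T E (Eq (map (tsub \<sigma>) ts ! i) (map (tsub \<sigma>) us ! i))"
  proof (rule derives.proj[where f = f])
    show "derives_eq \<Sigma> T E (Eq (Fn f (map (tsub \<sigma>) ts)) (Fn f (map (tsub \<sigma>) us)))"
      using proj.IH[OF proj.prems] by simp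
    show "\<forall>j<arity \<Sigma> f. {[0, j], [1, j]} \<subseteq> abs_pos_assn \<Sigma> T
        (Eq (Fn f (map (tsub \<sigma>) ts)) (Fn f (map (tsub \<sigma>) us)) :: ('p, 'f, 'n, 'v) assn)"
      using dy' proj(3,4) by (auto simp: Cons_abs_pos Nil_abs_pos)
  qed (use proj in auto)
  then show ?case
    using proj(3-5) by simp
next
  case (subst S A t ns u)
  then show ?case by (auto intro: derives.subst)
next
  case (exI P x \<alpha> S A t)
  have "sat \<Sigma> T E D (\<sigma>(x := tsub \<sigma> t)) \<alpha>"
    using exI sat_replace by metis
  moreover have "dy \<Sigma> T (tsub \<sigma> t)"
    using exI.hyps(4) exI.prems(4) wf by (rule dy_tsub)
  \<comment> \<open>With the binders in \<open>D\<close>, \<open>x\<close> lies neither in the other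
    values of \<open>\<sigma>\<close> nor in \<open>S0\<close>, so the abstractability required by
    the rule survives the instantiation.\<close>
  moreover have "abstr_assn \<Sigma> (T \<union> {Var x}) x (asub (\<sigma>(x := Var x)) \<alpha>)" if D: "insert x (bv \<alpha>) \<subseteq> D"
  proof (rule abstr_assn_asub[OF _ _ wf])
    show "abstr_assn \<Sigma> (S \<union> {Var x}) x \<alpha>"
      using exI.hyps(2,5) by (simp add: abstr_assn_def)
    show "\<forall>s\<in>S \<union> {Var x}. dy \<Sigma> (T \<union> {Var x}) (tsub (\<sigma>(x := Var x)) s)"
    proof
      fix s assume s: "s \<in> S \<union> {Var x}"
      show "dy \<Sigma> (T \<union> {Var x}) (tsub (\<sigma>(x := Var x)) s)"
      proof (cases "s = Var x")
        case False
        then have "s \<in> S0 \<or> (\<exists>w. s = Var w)"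
          using s exI.prems(3) by blast
        then have "x \<notin> vars s"
          using False D S0D by auto
        then have "tsub (\<sigma>(x := Var x)) s = tsub \<sigma> s"
          by (intro tsub_cong) auto
        then show ?thesis
          using False s exI.prems(4) by (auto intro: dy_mono)
      qed (simp add: dy_ax)
    qed
    show "\<forall>w. w \<noteq> x \<longrightarrow> x \<notin> vars ((\<sigma>(x := Var x)) w)"
      using exI.prems(2) D by auto
    show "S \<union> {Var x} \<subseteq> S0 \<union> range Var"
      using exI.prems(3) by auto
    show "(\<Union>s\<in>S0. vars s) \<inter> bv \<alpha> = {}"
      using S0D D by auto
    show "x \<notin> bv \<alpha>"
      using exI.hyps(7) by (rule regularD)
  qed simp
  ultimately show ?case by auto
next
  case (exE P x \<alpha> S A y \<gamma>)
  have r: "regular (Ex x \<alpha>)"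
    using derives_regular exE by blast
  obtain t where t: "dy \<Sigma> T t" "sat \<Sigma> T E D (\<sigma>(x := t)) \<alpha>"
    using exE.IH(1)[OF exE.prems] by auto
  \<comment> \<open>The eigenvariable is interpreted by the witness of the premise; being fresh, it
    affects neither \<open>S\<close>, \<open>A\<close> nor \<open>\<gamma>\<close>.\<close>
  let ?\<sigma> = "\<sigma>(y := t)"
  have fv: "fv (Ex x \<alpha>) \<subseteq> fv_seq S A"
    using exE.hyps(3) exE.prems(1) wf by (rule derives_fv)
  have "sat \<Sigma> T E D ?\<sigma> \<gamma>"
  proof (rule exE.IH(2))
    have "regular (asub (Var(x := Var y)) \<alpha>)"
      using r fv_asub_single[of x "Var y" \<alpha>] exE.hyps(6) unfolding regular_def by auto
    then show "\<forall>\<beta>\<in>A \<union> {replace_assn \<alpha> P (Var y)}. regular \<beta>"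
      using exE.prems(1) exE.hyps(2) regularD(4)[OF r] by (auto simp: replace_pos_of_assn)
    show "\<forall>w. vars (?\<sigma> w) \<inter> D = {}"
      using exE.prems(2) dy_vars[OF t(1) wf] TD by auto
    show "S \<union> {Var y} \<subseteq> S0 \<union> range Var"
      using exE.prems(3) by auto
    show "\<forall>s\<in>S \<union> {Var y}. dy \<Sigma> T (tsub ?\<sigma> s)"
    proof
      fix s assume s: "s \<in> S \<union> {Var y}"
      show "dy \<Sigma> T (tsub ?\<sigma> s)"
      proof (cases "s = Var y")
        case False
        then have "y \<notin> vars s"
          using s exE.hyps(5) by (auto simp: fv_seq_def)
        then have "tsub ?\<sigma> s = tsub \<sigma> s"
          by (intro tsub_cong) auto
        then show ?thesis
          using False s exE.prems(4) by auto
      qed (simp add: t)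
    qed
    have "sat \<Sigma> T E D ?\<sigma> \<beta>" if "\<beta> \<in> A" for \<beta>
    proof -
      have "sat \<Sigma> T E D ?\<sigma> \<beta> = sat \<Sigma> T E D \<sigma> \<beta>"
        using that exE.hyps(5) by (intro sat_cong) (auto simp: fv_seq_def)
      then show ?thesis using that exE.prems(5) by blast
    qed
    moreover have "sat \<Sigma> T E D ?\<sigma> (replace_assn \<alpha> P (Var y))"
    proof -
      have "sat \<Sigma> T E D ?\<sigma> (replace_assn \<alpha> P (Var y)) = sat \<Sigma> T E D (?\<sigma>(x := t)) \<alpha>"
        unfolding exE.hyps(2) using sat_replace[OF r, of "Var y"] exE.hyps(6) by simp
      \<comment> \<open>If \<open>y\<close> differs from \<open>x\<close>, it is not free in
        \<open>\<alpha>\<close> by \<open>fv\<close>; if they coincide, the update at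
        \<open>x\<close> overrides the one at \<open>y\<close>.\<close>
      also have "\<dots> = sat \<Sigma> T E D (\<sigma>(x := t)) \<alpha>"
        using fv exE.hyps(5) by (intro sat_cong) auto
      finally show ?thesis using t(2) by simp
    qed
    ultimately show "\<forall>\<beta>\<in>A \<union> {replace_assn \<alpha> P (Var y)}. sat \<Sigma> T E D ?\<sigma> \<beta>"
      by blast
  qed
  moreover have "sat \<Sigma> T E D ?\<sigma> \<gamma> = sat \<Sigma> T E D \<sigma> \<gamma>"
    using exE.hyps(5) by (intro sat_cong) auto
  ultimately show ?case by simp
next
  case (say S A \<alpha> k)
  then show ?case
    using dy_tsub[OF say(3) say.prems(4) wf] by simp
next
  case (prom S A t n)
  then show ?case by (auto intro: derives.prom)
next
  case (int ls S A t ns)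
  then have "\<forall>l\<in>set ls. derives_eq \<Sigma> T E (Mem (tsub \<sigma> t) l)"
    by simp
  from derives.int[OF _ int(2) this int.hyps(3)] show ?case
    by simp
next
  case (wk n ns S A t)
  have "dy \<Sigma> T (Name n')" if "n' \<in> set ns" for n'
    using dy_tsub[OF wk(4)[rule_format, OF that] wk.prems(4) wf] by simp
  then show ?case
    using wk by (auto intro!: derives.wk[where n = n])
qed auto

section \<open>Extraction of a normal derivation\<close>

lemma abs_pos_mono: "S \<subseteq> S' \<Longrightarrow> abs_pos \<Sigma> S t \<subseteq> abs_pos \<Sigma> S' t"
  unfolding abs_pos_def using dy_mono by blast

lemma derives_exI:
  assumes "R_exI \<in> R" "derives \<Sigma> R S A (asub (Var(x := t)) \<alpha>)" "dy \<Sigma> S t"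
    and "abstr_assn \<Sigma> (S \<union> {Var x}) x \<alpha>" "x \<in> Vq \<Sigma>" "regular (Ex x \<alpha>)" "vars t \<inter> bv \<alpha> = {}"
  shows "derives \<Sigma> R S A (Ex x \<alpha>)"
proof (rule derives.exI[OF _ refl, where t = t])
  show "derives \<Sigma> R S A (replace_assn \<alpha> (pos_of_assn \<Sigma> (Var x) \<alpha>) t)"
    using assms(2) by (simp only: replace_pos_of_assn[OF regularD(4)[OF assms(6)]])
qed (use assms in \<open>auto simp: abstr_assn_def\<close>)

text \<open>Weakening and cut together. (\<exists>E) is excluded because its eigenvariable may occur
  in \<open>S'\<close> or \<open>A'\<close>.\<close>

lemma derives_cut:
  fixes A A' :: "('p, 'f, 'n, 'v) assn set"
  assumes "derives \<Sigma> R S A \<alpha>" "R_exE \<notin> R" "R \<subseteq> R'"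
  shows "S \<subseteq> S' \<Longrightarrow> \<forall>\<beta>\<in>A. derives \<Sigma> R' S' A' \<beta> \<Longrightarrow> derives \<Sigma> R' S' A' \<alpha>"
  using assms(1)
proof (induction rule: derives.induct)
  case (eq S t A)
  then show ?case using assms(3) by (auto intro: derives.eq dy_mono)
next
  case (cons ts f us S A)
  then show ?case using assms(3) by (intro derives.cons) auto
next
  case (sym S A t u)
  then show ?case using assms(3) by (intro derives.sym[of _ _ _ _ t u]) auto
next
  case (trans ts k S A)
  then show ?case using assms(3) by (intro derives.trans) auto
next
  case (proj S A f ts us i)
  have "{[0, j], [1, j]} \<subseteq> abs_pos_assn \<Sigma> S' (Eq (Fn f ts) (Fn f us) :: ('p, 'f, 'n, 'v) assn)"
    if "j < arity \<Sigma> f" for j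
    using proj(6) that abs_pos_mono[OF proj.prems(1)] by fastforce
  then show ?case
    using proj assms(3) by (intro derives.proj[of _ _ _ _ f ts us]) auto
next
  case (conjI S A \<alpha> \<beta>)
  then show ?case using assms(3) by (intro derives.conjI) auto
next
  case (conjE1 S A \<alpha> \<beta>)
  then show ?case using assms(3) by (intro derives.conjE1[of _ _ _ _ \<alpha> \<beta>]) auto
next
  case (conjE2 S A \<alpha> \<beta>)
  then show ?case using assms(3) by (intro derives.conjE2[of _ _ _ _ \<alpha> \<beta>]) auto
next
  case (subst S A t ns u)
  then show ?case using assms(3) by (intro derives.subst[of _ _ _ _ t ns u]) auto
next
  case (exI P x \<alpha> S A t)
  have "abstr_assn \<Sigma> (S' \<union> {Var x}) x \<alpha>"
    by (rule abstr_assn_mono[of _ "S \<union> {Var x}"]) (use exI.hyps(2,5) exI.prems(1) in \<open>auto simp: abstr_assn_def\<close>)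
  moreover have "derives \<Sigma> R' S' A' (asub (Var(x := t)) \<alpha>)"
    using exI.IH[OF exI.prems]
    by (simp only: exI.hyps(2) replace_pos_of_assn[OF regularD(4)[OF exI.hyps(7)]])
  ultimately show ?case
    using exI.hyps assms(3) dy_mono[OF exI.hyps(4) exI.prems(1)]
    by (intro derives_exI[where t = t]) auto
next
  case (exE P x \<alpha> S A y \<gamma>)
  then show ?case using assms(2) by simp
next
  case (say S A \<alpha> k)
  then show ?case using assms(3) by (intro derives.say) (auto intro: dy_mono)
next
  case (prom S A t n)
  then show ?case using assms(3) by (intro derives.prom) auto
next
  case (int ls S A t ns)
  then show ?case using assms(3) by (intro derives.int[of _ ls]) auto
next
  case (wk n ns S A t)
  then show ?case using assms(3) by (intro derives.wk[of _ n]) (auto intro: dy_mono)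
qed auto

lemma hat_fv: "\<beta> \<in> hat \<alpha> \<Longrightarrow> fv \<beta> \<subseteq> fv \<alpha> \<union> bv \<alpha>"
  by (induction \<alpha>) auto

lemma regular_asub:
  assumes "regular \<alpha>" "\<forall>w\<in>fv \<alpha>. vars (\<sigma> w) \<inter> bv \<alpha> = {}"
  shows "regular (asub \<sigma> \<alpha>)"
  using assms fv_asub[of \<sigma> \<alpha>] unfolding regular_def by fastforce

lemma sat_extract:
  fixes E :: "('p, 'f, 'n, 'v) assn set"
  assumes wf: "\<forall>d\<in>drules \<Sigma>. wf_drule \<Sigma> d"
    and TD: "(\<Union>t\<in>T. vars t) \<inter> D = {}" and ED: "\<forall>\<beta>\<in>E. bv \<beta> \<inter> D = {}"
  shows "sat \<Sigma> T E D \<sigma> \<alpha> \<Longrightarrow> wf_assn \<Sigma> \<alpha> \<Longrightarrow> regular \<alpha> \<Longrightarrow> bv \<alpha> \<subseteq> D \<Longrightarrow> bv \<alpha> \<inter> Y = {} \<Longrightarrow>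
    \<forall>w\<in>fv \<alpha> - Y. \<sigma> w = Var w \<Longrightarrow> \<forall>w\<in>fv \<alpha>. vars (\<sigma> w) \<inter> D = {} \<Longrightarrow>
    \<forall>y\<in>Y. abstr_assn \<Sigma> (T \<union> Var ` D) y \<alpha> \<Longrightarrow>
    \<exists>X \<rho>. X \<subseteq> hat \<alpha> \<and> bvs X = {} \<and> (\<forall>x. x \<notin> bv \<alpha> \<longrightarrow> \<rho> x = \<sigma> x) \<and> (\<forall>x\<in>bv \<alpha>. dy \<Sigma> T (\<rho> x)) \<and>
      (\<forall>\<beta>\<in>X. derives_eq \<Sigma> T E (asub \<rho> \<beta>)) \<and>
      derives_intro \<Sigma> T (asub \<rho> ` X) (asub \<sigma> \<alpha>) \<and>
      (\<forall>x\<in>bv \<alpha>. abstr_assn \<Sigma> (T \<union> Var ` D) x \<alpha>)"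
proof (induction \<alpha> arbitrary: \<sigma> Y)
  case (Conj \<alpha> \<beta>)
  have reg: "regular \<alpha>" "regular \<beta>" "bv \<alpha> \<inter> bv \<beta> = {}" "fv \<alpha> \<inter> bv \<beta> = {}" "fv \<beta> \<inter> bv \<alpha> = {}"
    using Conj.prems(3) by (auto simp: regular_def)
  have "\<exists>X \<rho>. X \<subseteq> hat \<alpha> \<and> bvs X = {} \<and> (\<forall>x. x \<notin> bv \<alpha> \<longrightarrow> \<rho> x = \<sigma> x) \<and> (\<forall>x\<in>bv \<alpha>. dy \<Sigma> T (\<rho> x)) \<and>
      (\<forall>\<beta>\<in>X. derives_eq \<Sigma> T E (asub \<rho> \<beta>)) \<and> derives_intro \<Sigma> T (asub \<rho> ` X) (asub \<sigma> \<alpha>) \<and>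
      (\<forall>x\<in>bv \<alpha>. abstr_assn \<Sigma> (T \<union> Var ` D) x \<alpha>)"
    by (rule Conj.IH(1)[of _ Y]) (use Conj.prems reg in \<open>auto simp: abstr_assn_simps\<close>)
  then obtain X1 \<rho>1 where 1: "X1 \<subseteq> hat \<alpha>" "bvs X1 = {}" "\<forall>x. x \<notin> bv \<alpha> \<longrightarrow> \<rho>1 x = \<sigma> x"
    "\<forall>x\<in>bv \<alpha>. dy \<Sigma> T (\<rho>1 x)" "\<forall>\<beta>\<in>X1. derives_eq \<Sigma> T E (asub \<rho>1 \<beta>)"
    "derives_intro \<Sigma> T (asub \<rho>1 ` X1) (asub \<sigma> \<alpha>)"
    "\<forall>x\<in>bv \<alpha>. abstr_assn \<Sigma> (T \<union> Var ` D) x \<alpha>"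
    by blast
  have "\<exists>X \<rho>. X \<subseteq> hat \<beta> \<and> bvs X = {} \<and> (\<forall>x. x \<notin> bv \<beta> \<longrightarrow> \<rho> x = \<sigma> x) \<and> (\<forall>x\<in>bv \<beta>. dy \<Sigma> T (\<rho> x)) \<and>
      (\<forall>\<beta>\<in>X. derives_eq \<Sigma> T E (asub \<rho> \<beta>)) \<and> derives_intro \<Sigma> T (asub \<rho> ` X) (asub \<sigma> \<beta>) \<and>
      (\<forall>x\<in>bv \<beta>. abstr_assn \<Sigma> (T \<union> Var ` D) x \<beta>)"
    by (rule Conj.IH(2)[of _ Y]) (use Conj.prems reg in \<open>auto simp: abstr_assn_simps\<close>)
  then obtain X2 \<rho>2 where 2: "X2 \<subseteq> hat \<beta>" "bvs X2 = {}" "\<forall>x. x \<notin> bv \<beta> \<longrightarrow> \<rho>2 x = \<sigma> x"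
    "\<forall>x\<in>bv \<beta>. dy \<Sigma> T (\<rho>2 x)" "\<forall>\<beta>\<in>X2. derives_eq \<Sigma> T E (asub \<rho>2 \<beta>)"
    "derives_intro \<Sigma> T (asub \<rho>2 ` X2) (asub \<sigma> \<beta>)"
    "\<forall>x\<in>bv \<beta>. abstr_assn \<Sigma> (T \<union> Var ` D) x \<beta>"
    by blast
  \<comment> \<open>By regularity the atoms of one conjunct do not mention the binders of the other;
    outside the binders both environments agree with \<open>\<sigma>\<close>.\<close>
  define \<rho> where "\<rho> x = (if x \<in> bv \<beta> then \<rho>2 x else \<rho>1 x)" for x
  have \<rho>1: "asub \<rho> \<gamma> = asub \<rho>1 \<gamma>" if "\<gamma> \<in> X1" for \<gamma>
    using hat_fv[of \<gamma> \<alpha>] that 1(1) reg by (intro asub_cong) (auto simp: \<rho>_def)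
  have \<rho>2: "asub \<rho> \<gamma> = asub \<rho>2 \<gamma>" if "\<gamma> \<in> X2" for \<gamma>
  proof (rule asub_cong)
    fix x assume "x \<in> fv \<gamma>"
    then have "x \<in> fv \<beta> \<union> bv \<beta>"
      using hat_fv[of \<gamma> \<beta>] that 2(1) by auto
    then show "\<rho> x = \<rho>2 x"
      using reg(5) 1(3) 2(3) by (auto simp: \<rho>_def)
  qed
  have img: "asub \<rho> ` (X1 \<union> X2) = asub \<rho>1 ` X1 \<union> asub \<rho>2 ` X2"
    using \<rho>1 \<rho>2 by (auto simp: image_Un)
  have "derives_intro \<Sigma> T (asub \<rho> ` (X1 \<union> X2)) (asub \<sigma> \<alpha>)"
    unfolding img by (rule derives_cut[OF 1(6)]) (auto intro: derives.ax)
  moreover have "derives_intro \<Sigma> T (asub \<rho> ` (X1 \<union> X2)) (asub \<sigma> \<beta>)"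
    unfolding img by (rule derives_cut[OF 2(6)]) (auto intro: derives.ax)
  moreover have "regular (asub \<sigma> (Conj \<alpha> \<beta>))"
    using Conj.prems(3,4,7) by (intro regular_asub) auto
  ultimately have "derives_intro \<Sigma> T (asub \<rho> ` (X1 \<union> X2)) (asub \<sigma> (Conj \<alpha> \<beta>))"
    by (auto intro: derives.conjI)
  moreover have "abstr_assn \<Sigma> (T \<union> Var ` D) x (Conj \<alpha> \<beta>)" if "x \<in> bv \<alpha> \<union> bv \<beta>" for x
    using that 1(7) 2(7) reg abstr_assn_notin[of x \<alpha>] abstr_assn_notin[of x \<beta>]
    unfolding abstr_assn_simps by blast
  moreover have "\<forall>\<gamma>\<in>X1 \<union> X2. derives_eq \<Sigma> T E (asub \<rho> \<gamma>)"
    using 1(5) 2(5) \<rho>1 \<rho>2 by auto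
  moreover have "bvs (X1 \<union> X2) = {}" "X1 \<union> X2 \<subseteq> hat (Conj \<alpha> \<beta>)"
    using 1(1,2) 2(1,2) by (auto simp: bvs_def)
  moreover have "\<forall>x. x \<notin> bv (Conj \<alpha> \<beta>) \<longrightarrow> \<rho> x = \<sigma> x" "\<forall>x\<in>bv (Conj \<alpha> \<beta>). dy \<Sigma> T (\<rho> x)"
    using 1(3,4) 2(3,4) by (auto simp: \<rho>_def)
  ultimately show ?case
    by (intro HOL.exI[of _ "X1 \<union> X2"] HOL.exI[of _ \<rho>]) auto
next
  case (Ex x \<alpha>)
  let ?V = "T \<union> Var ` D"
  let ?\<alpha> = "asub (\<sigma>(x := Var x)) \<alpha>"
  have reg: "regular \<alpha>" "x \<notin> bv \<alpha>" and xD: "x \<in> D"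
    using Ex.prems(3,4) by (auto dest: regularD)
  then have V: "?V \<union> {Var x} = ?V"
    by auto
  have abs: "abstr_assn \<Sigma> (T \<union> {Var x}) x ?\<alpha>"
    using Ex.prems(1,4) by auto
  obtain t where t: "dy \<Sigma> T t" "sat \<Sigma> T E D (\<sigma>(x := t)) \<alpha>"
    using Ex.prems(1) by auto
  have tD: "vars t \<inter> D = {}"
    using dy_vars[OF t(1) wf] TD by auto
  \<comment> \<open>Satisfaction gives abstractability only in the instance
    \<open>?\<alpha>\<close>; it is pulled back to \<open>\<alpha>\<close> using that the variables
    of \<open>Y\<close> are abstractable there. Then \<open>x\<close> itself joins
    \<open>Y\<close>.\<close>
  have "abstr_assn \<Sigma> ?V x \<alpha>"
  proof (rule abstr_assn_asubD)
    show "abstr_assn \<Sigma> ?V x ?\<alpha>"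
      by (rule abstr_assn_mono[OF abs]) (use xD in auto)
    show "\<forall>y\<in>Y. abstr_assn \<Sigma> ?V y \<alpha>"
      using Ex.prems(8) V by (simp add: abstr_assn_simps)
  qed (use Ex.prems(4-6) in auto)
  then have Y: "\<forall>y\<in>insert x Y. abstr_assn \<Sigma> ?V y \<alpha>"
    using Ex.prems(8) V by (simp add: abstr_assn_simps)
  have "\<exists>X \<rho>. X \<subseteq> hat \<alpha> \<and> bvs X = {} \<and> (\<forall>y. y \<notin> bv \<alpha> \<longrightarrow> \<rho> y = (\<sigma>(x := t)) y) \<and> (\<forall>x\<in>bv \<alpha>. dy \<Sigma> T (\<rho> x)) \<and>
      (\<forall>\<beta>\<in>X. derives_eq \<Sigma> T E (asub \<rho> \<beta>)) \<and> derives_intro \<Sigma> T (asub \<rho> ` X) (asub (\<sigma>(x := t)) \<alpha>) \<and>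
      (\<forall>x\<in>bv \<alpha>. abstr_assn \<Sigma> ?V x \<alpha>)"
    by (rule Ex.IH[OF t(2) _ _ _ _ _ _ Y]) (use Ex.prems(2-7) reg tD in auto)
  then obtain X \<rho> where X: "X \<subseteq> hat \<alpha>" "bvs X = {}" "\<forall>y. y \<notin> bv \<alpha> \<longrightarrow> \<rho> y = (\<sigma>(x := t)) y"
    "\<forall>x\<in>bv \<alpha>. dy \<Sigma> T (\<rho> x)" "\<forall>\<beta>\<in>X. derives_eq \<Sigma> T E (asub \<rho> \<beta>)"
    "derives_intro \<Sigma> T (asub \<rho> ` X) (asub (\<sigma>(x := t)) \<alpha>)"
    "\<forall>x\<in>bv \<alpha>. abstr_assn \<Sigma> ?V x \<alpha>"
    by blast
  \<comment> \<open>(\<exists>I) acts on the instance in which \<open>x\<close> is kept. Putting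
    \<open>t\<close> for \<open>x\<close> afterwards equals instantiating at once, because no other
    relevant value of \<open>\<sigma>\<close> contains \<open>x\<close>.\<close>
  have "asub (Var(x := t)) ?\<alpha> = asub (\<lambda>w. tsub (Var(x := t)) ((\<sigma>(x := Var x)) w)) \<alpha>"
    by (rule asub_asub) (use Ex.prems(4,7) reg in \<open>auto simp: regular_def\<close>)
  also have "\<dots> = asub (\<sigma>(x := t)) \<alpha>"
  proof (rule asub_cong)
    fix w assume w: "w \<in> fv \<alpha>"
    show "tsub (Var(x := t)) ((\<sigma>(x := Var x)) w) = (\<sigma>(x := t)) w"
    proof (cases "w = x")
      case False
      then have "x \<notin> vars (\<sigma> w)"
        using Ex.prems(7) w xD by auto
      then have "tsub (Var(x := t)) (\<sigma> w) = tsub Var (\<sigma> w)"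
        by (intro tsub_cong) auto
      then show ?thesis using False by simp
    qed simp
  qed
  finally have "derives_intro \<Sigma> T (asub \<rho> ` X) (asub (Var(x := t)) ?\<alpha>)"
    using X(6) by (simp only:)
  moreover have "regular (asub \<sigma> (Ex x \<alpha>))"
    using Ex.prems(3,4,7) by (intro regular_asub) auto
  ultimately have "derives_intro \<Sigma> T (asub \<rho> ` X) (Ex x ?\<alpha>)"
    using abs t(1) tD Ex.prems(2,4)
    by (intro derives_exI[where t = t]) auto
  moreover have "\<forall>y\<in>bv (Ex x \<alpha>). abstr_assn \<Sigma> ?V y (Ex x \<alpha>)"
    using X(7) Y V by (simp add: abstr_assn_simps)
  moreover have "\<forall>y. y \<notin> bv (Ex x \<alpha>) \<longrightarrow> \<rho> y = \<sigma> y" "\<forall>y\<in>bv (Ex x \<alpha>). dy \<Sigma> T (\<rho> y)"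
    using X(3,4) reg(2) t(1) by auto
  ultimately show ?case
    using X(1,2,5) by (intro HOL.exI[of _ X] HOL.exI[of _ \<rho>]) auto
next
  case (Says k \<alpha>)
  show ?case
  proof (cases "asub \<sigma> (Says k \<alpha>) \<in> E")
    case True
    \<comment> \<open>The binders of \<open>\<alpha>\<close> lie in \<open>D\<close> and those of
      members of \<open>E\<close> do not; so there is none, and no witness has to be chosen.\<close>
    then have "bv \<alpha> = {}"
      using ED Says.prems(4) by fastforce
    then show ?thesis
      using True by (intro HOL.exI[of _ "{Says k \<alpha>}"] HOL.exI[of _ \<sigma>]) (auto simp: bvs_def intro: derives.ax)
  next
    case False
    then have s: "dy \<Sigma> T (tsub \<sigma> k)" "sat \<Sigma> T E D \<sigma> \<alpha>"
      using Says.prems(1) by auto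
    have "\<exists>X \<rho>. X \<subseteq> hat \<alpha> \<and> bvs X = {} \<and> (\<forall>x. x \<notin> bv \<alpha> \<longrightarrow> \<rho> x = \<sigma> x) \<and> (\<forall>x\<in>bv \<alpha>. dy \<Sigma> T (\<rho> x)) \<and>
      (\<forall>\<beta>\<in>X. derives_eq \<Sigma> T E (asub \<rho> \<beta>)) \<and> derives_intro \<Sigma> T (asub \<rho> ` X) (asub \<sigma> \<alpha>) \<and>
      (\<forall>x\<in>bv \<alpha>. abstr_assn \<Sigma> (T \<union> Var ` D) x \<alpha>)"
      by (rule Says.IH[OF s(2), of Y])
        (use Says.prems regularD in \<open>auto simp: abstr_assn_simps\<close>)
    then obtain X \<rho> where X: "X \<subseteq> hat \<alpha>" "bvs X = {}" "\<forall>x. x \<notin> bv \<alpha> \<longrightarrow> \<rho> x = \<sigma> x"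
      "\<forall>x\<in>bv \<alpha>. dy \<Sigma> T (\<rho> x)" "\<forall>\<beta>\<in>X. derives_eq \<Sigma> T E (asub \<rho> \<beta>)"
      "derives_intro \<Sigma> T (asub \<rho> ` X) (asub \<sigma> \<alpha>)"
      "\<forall>x\<in>bv \<alpha>. abstr_assn \<Sigma> (T \<union> Var ` D) x \<alpha>"
      by blast
    have "regular (asub \<sigma> (Says k \<alpha>))"
      using Says.prems(3,4,7) by (intro regular_asub) auto
    then have "derives_intro \<Sigma> T (asub \<rho> ` X) (asub \<sigma> (Says k \<alpha>))"
      using X(6) s(1) by (auto intro: derives.say)
    moreover have "\<forall>x\<in>bv (Says k \<alpha>). abstr_assn \<Sigma> (T \<union> Var ` D) x (Says k \<alpha>)"
      using X(7) Says.prems(3) by (auto simp: abstr_assn_simps regular_def)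
    ultimately show ?thesis
      using X(1-5) by (intro HOL.exI[of _ X] HOL.exI[of _ \<rho>]) auto
  qed
next
  case (Eq t u)
  then show ?case
    by (intro HOL.exI[of _ "{Eq t u}"] HOL.exI[of _ \<sigma>]) (auto simp: bvs_def intro: derives.ax)
next
  case (Pred P us)
  then show ?case
    by (intro HOL.exI[of _ "{Pred P us}"] HOL.exI[of _ \<sigma>]) (auto simp: bvs_def intro: derives.ax)
next
  case (Mem t ns)
  then show ?case
    by (intro HOL.exI[of _ "{Mem t ns}"] HOL.exI[of _ \<sigma>]) (auto simp: bvs_def intro: derives.ax)
qed

section \<open>Elimination of the kernel\<close>

definition derives_stably where
  "derives_stably \<Sigma> S A \<beta> \<longleftrightarrow> (\<forall>S' A'. S \<subseteq> S' \<longrightarrow> A \<subseteq> A' \<longrightarrow> derives_a \<Sigma> S' A' \<beta>)"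

lemma derives_stably_mono: "derives_stably \<Sigma> S A \<beta> \<Longrightarrow> S \<subseteq> S' \<Longrightarrow> A \<subseteq> A' \<Longrightarrow> derives_stably \<Sigma> S' A' \<beta>"
  unfolding derives_stably_def by (meson subset_trans)

lemma derives_stablyD: "derives_stably \<Sigma> S A \<beta> \<Longrightarrow> derives_a \<Sigma> S A \<beta>"
  by (simp add: derives_stably_def)

lemma fv_seq_mono: "S \<subseteq> S' \<Longrightarrow> A \<subseteq> A' \<Longrightarrow> fv_seq S A \<subseteq> fv_seq S' A'"
  by (fastforce simp: fv_seq_def)

text \<open>The bound variables outside the scope of \<open>says\<close>, which are the only ones that (\<open>\<exists>E\<close>) can free.\<close>

fun obv :: "('p, 'f, 'n, 'v) assn \<Rightarrow> 'v set" where
  "obv (Conj \<alpha> \<beta>) = obv \<alpha> \<union> obv \<beta>"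
| "obv (Ex x \<alpha>) = insert x (obv \<alpha>)"
| "obv \<gamma> = {}"

lemma obv_bv: "obv \<alpha> \<subseteq> bv \<alpha>"
  by (induction \<alpha>) auto

text \<open>The last premise is a continuation: it derives \<open>\<gamma>\<close> in every larger
  sequent where the atoms are available. The bound on \<open>fv_seq S' A'\<close> certifies that the
  binders still to be opened remain fresh.\<close>

lemma elim_assn:
  "derives_stably \<Sigma> S A \<beta> \<Longrightarrow> distinct_bv \<beta> \<Longrightarrow> bv \<beta> \<inter> (fv_seq S A \<union> fv \<beta> \<union> fv \<gamma>) = {} \<Longrightarrow>
    (\<And>S' A'. S \<union> Var ` obv \<beta> \<subseteq> S' \<Longrightarrow> A \<subseteq> A' \<Longrightarrow> fv_seq S' A' \<subseteq> fv_seq S A \<union> fv \<beta> \<union> bv \<beta> \<Longrightarrow>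
      \<forall>\<delta>\<in>at \<beta>. derives_stably \<Sigma> S' A' \<delta> \<Longrightarrow> derives_a \<Sigma> S' A' \<gamma>) \<Longrightarrow>
    derives_a \<Sigma> S A \<gamma>"
proof (induction \<beta> arbitrary: S A)
  case (Conj \<alpha> \<beta>)
  have st: "derives_stably \<Sigma> S A \<alpha>" "derives_stably \<Sigma> S A \<beta>"
    using Conj.prems(1) unfolding derives_stably_def by (blast intro: derives.conjE1 derives.conjE2)+
  show ?case
  proof (rule Conj.IH(1)[OF st(1)])
    fix S1 A1
    assume 1: "S \<union> Var ` obv \<alpha> \<subseteq> S1" "A \<subseteq> A1" "fv_seq S1 A1 \<subseteq> fv_seq S A \<union> fv \<alpha> \<union> bv \<alpha>"
      "\<forall>\<delta>\<in>at \<alpha>. derives_stably \<Sigma> S1 A1 \<delta>"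
    show "derives_a \<Sigma> S1 A1 \<gamma>"
    proof (rule Conj.IH(2))
      show "derives_stably \<Sigma> S1 A1 \<beta>"
        using derives_stably_mono[OF st(2)] 1(1,2) by auto
      show "bv \<beta> \<inter> (fv_seq S1 A1 \<union> fv \<beta> \<union> fv \<gamma>) = {}"
        using Conj.prems(2,3) 1(3) by auto
      fix S2 A2
      assume 2: "S1 \<union> Var ` obv \<beta> \<subseteq> S2" "A1 \<subseteq> A2" "fv_seq S2 A2 \<subseteq> fv_seq S1 A1 \<union> fv \<beta> \<union> bv \<beta>"
        "\<forall>\<delta>\<in>at \<beta>. derives_stably \<Sigma> S2 A2 \<delta>"
      show "derives_a \<Sigma> S2 A2 \<gamma>"
      proof (rule Conj.prems(4))
        show "\<forall>\<delta>\<in>at (Conj \<alpha> \<beta>). derives_stably \<Sigma> S2 A2 \<delta>"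
          using 2 1(4) derives_stably_mono[of \<Sigma> S1 A1 _ S2 A2] by auto
      qed (use 1(1-3) 2(1-3) in auto)
    qed (use Conj.prems(2) in auto)
  qed (use Conj.prems(2,3) in auto)
next
  case (Ex x \<alpha>)
  have x: "x \<notin> bv \<alpha>"
    using Ex.prems(2) by simp
  \<comment> \<open>With \<open>x\<close> as its own eigenvariable, the replacement made by
    (\<exists>E) is the identity.\<close>
  have "replace_assn \<alpha> (pos_of_assn \<Sigma> (Var x) \<alpha>) (Var x) = asub (Var(x := Var x)) \<alpha>"
    by (rule replace_pos_of_assn[OF x])
  then have eq: "replace_assn \<alpha> (pos_of_assn \<Sigma> (Var x) \<alpha>) (Var x) = \<alpha>"
    by (simp only: fun_upd_triv asub_Var)
  have "derives_a \<Sigma> (S \<union> {Var x}) (A \<union> {\<alpha>}) \<gamma>"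
  proof (rule Ex.IH)
    show "derives_stably \<Sigma> (S \<union> {Var x}) (A \<union> {\<alpha>}) \<alpha>"
      unfolding derives_stably_def by (auto intro: derives.ax)
    show "bv \<alpha> \<inter> (fv_seq (S \<union> {Var x}) (A \<union> {\<alpha>}) \<union> fv \<alpha> \<union> fv \<gamma>) = {}"
      using Ex.prems(3) x by (auto simp: fv_seq_def)
    fix S' A'
    assume "S \<union> {Var x} \<union> Var ` obv \<alpha> \<subseteq> S'" "A \<union> {\<alpha>} \<subseteq> A'"
      "fv_seq S' A' \<subseteq> fv_seq (S \<union> {Var x}) (A \<union> {\<alpha>}) \<union> fv \<alpha> \<union> bv \<alpha>"
      "\<forall>\<delta>\<in>at \<alpha>. derives_stably \<Sigma> S' A' \<delta>"
    then show "derives_a \<Sigma> S' A' \<gamma>"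
      by (intro Ex.prems(4)) (auto simp: fv_seq_def)
  qed (use Ex.prems(2) in simp)
  then have "derives_a \<Sigma> (S \<union> {Var x}) (A \<union> {replace_assn \<alpha> (pos_of_assn \<Sigma> (Var x) \<alpha>) (Var x)}) \<gamma>"
    by (simp only: eq)
  with derives_stablyD[OF Ex.prems(1)] show ?case
    by (rule derives.exE[OF UNIV_I refl]) (use Ex.prems(3) x in auto)
next
  case (Eq t u)
  show ?case by (rule Eq.prems(4)) (use Eq.prems(1) in auto)
next
  case (Pred P us)
  show ?case by (rule Pred.prems(4)) (use Pred.prems(1) in auto)
next
  case (Mem t ns)
  show ?case by (rule Mem.prems(4)) (use Mem.prems(1) in auto)
next
  case (Says k \<alpha>)
  show ?case by (rule Says.prems(4)) (use Says.prems(1) in auto)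
qed

text \<open>Iterates the previous lemma. As binders are pairwise disjoint, the variables freed from
  one assertion cannot clash with the eigenvariables of the next.\<close>

lemma elim_assns:
  assumes "finite B"
  shows "\<forall>\<beta>\<in>B. derives_stably \<Sigma> S A \<beta> \<and> distinct_bv \<beta> \<and> fv \<beta> \<subseteq> fv_seq S A \<and> bv \<beta> \<inter> (fv_seq S A \<union> fv \<gamma>) = {} \<Longrightarrow>
    \<forall>\<beta>\<in>B. \<forall>\<delta>\<in>B. \<beta> \<noteq> \<delta> \<longrightarrow> bv \<beta> \<inter> bv \<delta> = {} \<Longrightarrow>
    (\<And>S' A'. S \<union> Var ` (\<Union>\<beta>\<in>B. obv \<beta>) \<subseteq> S' \<Longrightarrow> A \<subseteq> A' \<Longrightarrow>
      \<forall>\<beta>\<in>B. \<forall>\<delta>\<in>at \<beta>. derives_stably \<Sigma> S' A' \<delta> \<Longrightarrow> derives_a \<Sigma> S' A' \<gamma>) \<Longrightarrow>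
    derives_a \<Sigma> S A \<gamma>"
  using assms
proof (induction B arbitrary: S A rule: finite_induct)
  case empty
  then show ?case by (simp add: bvs_def)
next
  case (insert \<beta> B)
  have \<beta>: "derives_stably \<Sigma> S A \<beta>" "distinct_bv \<beta>" "fv \<beta> \<subseteq> fv_seq S A"
      "bv \<beta> \<inter> (fv_seq S A \<union> fv \<gamma>) = {}"
    using bspec[OF insert.prems(1) insertI1] by simp_all
  have fresh: "bv \<beta> \<inter> (fv_seq S A \<union> fv \<beta> \<union> fv \<gamma>) = {}"
    using \<beta>(3,4) by blast
  have "derives_a \<Sigma> S1 A1 \<gamma>"
    if 1: "S \<union> Var ` obv \<beta> \<subseteq> S1" "A \<subseteq> A1" "fv_seq S1 A1 \<subseteq> fv_seq S A \<union> fv \<beta> \<union> bv \<beta>"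
      "\<forall>\<delta>\<in>at \<beta>. derives_stably \<Sigma> S1 A1 \<delta>" for S1 A1
  proof (rule insert.IH)
    have S1: "S \<subseteq> S1"
      using 1(1) by simp
    show "\<forall>\<delta>\<in>B. derives_stably \<Sigma> S1 A1 \<delta> \<and> distinct_bv \<delta> \<and> fv \<delta> \<subseteq> fv_seq S1 A1 \<and>
        bv \<delta> \<inter> (fv_seq S1 A1 \<union> fv \<gamma>) = {}"
    proof
      fix \<delta> assume "\<delta> \<in> B"
      then have \<delta>: "\<delta> \<in> insert \<beta> B" "\<beta> \<noteq> \<delta>"
        using insert.hyps(2) by auto
      note d = bspec[OF insert.prems(1) \<delta>(1)]
      have "bv \<beta> \<inter> bv \<delta> = {}"
        using insert.prems(2) \<delta> by simp
      moreover have "bv \<delta> \<inter> (fv_seq S A \<union> fv \<gamma>) = {}"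
        using d by simp
      ultimately have "bv \<delta> \<inter> (fv_seq S1 A1 \<union> fv \<gamma>) = {}"
        using 1(3) \<beta>(3) by blast
      moreover have "derives_stably \<Sigma> S1 A1 \<delta>"
        by (rule derives_stably_mono[OF _ S1 1(2)]) (simp add: d)
      moreover have "fv \<delta> \<subseteq> fv_seq S1 A1"
        by (rule order_trans[OF _ fv_seq_mono[OF S1 1(2)]]) (simp add: d)
      ultimately show "derives_stably \<Sigma> S1 A1 \<delta> \<and> distinct_bv \<delta> \<and> fv \<delta> \<subseteq> fv_seq S1 A1 \<and>
          bv \<delta> \<inter> (fv_seq S1 A1 \<union> fv \<gamma>) = {}"
        using d by simp
    qed
    show "\<forall>\<beta>\<in>B. \<forall>\<delta>\<in>B. \<beta> \<noteq> \<delta> \<longrightarrow> bv \<beta> \<inter> bv \<delta> = {}"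
      using insert.prems(2) by simp
    fix S2 A2
    assume 2: "S1 \<union> Var ` (\<Union>\<beta>\<in>B. obv \<beta>) \<subseteq> S2" "A1 \<subseteq> A2" "\<forall>\<beta>\<in>B. \<forall>\<delta>\<in>at \<beta>. derives_stably \<Sigma> S2 A2 \<delta>"
    have S2: "S1 \<subseteq> S2"
      using 2(1) by simp
    show "derives_a \<Sigma> S2 A2 \<gamma>"
    proof (rule insert.prems(3))
      show "S \<union> Var ` (\<Union>\<beta>\<in>insert \<beta> B. obv \<beta>) \<subseteq> S2"
        using 1(1) 2(1) by (simp add: image_Un image_UN) blast
      show "A \<subseteq> A2"
        using 1(2) 2(2) by (rule order_trans)
      have "derives_stably \<Sigma> S2 A2 \<delta>" if "\<delta> \<in> at \<beta>" for \<delta>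
        using derives_stably_mono[OF bspec[OF 1(4) that] S2 2(2)] .
      then show "\<forall>\<beta>\<in>insert \<beta> B. \<forall>\<delta>\<in>at \<beta>. derives_stably \<Sigma> S2 A2 \<delta>"
        using 2(3) by simp
    qed
  qed
  from elim_assn[OF \<beta>(1,2) fresh this] show ?case .
qed

text \<open>Every binder must lie in \<open>W\<close>, where \<open>\<sigma>\<close> is the identity
  and whose variables no other value mentions; then nothing is captured. Without (\<and>E) and
  (\<exists>E) this passes from conclusion to premises, whereas a premise of (\<and>E) could bring
  in further binders.\<close>

lemma derives_asub:
  fixes A :: "('p, 'f, 'n, 'v) assn set"
  assumes "derives \<Sigma> R S A \<gamma>" and R: "R_exE \<notin> R" "R_conjE \<notin> R"
    and wf: "\<forall>d\<in>drules \<Sigma>. wf_drule \<Sigma> d"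
    and S0: "S \<subseteq> S0 \<union> range Var" "(\<Union>s\<in>S0. vars s) \<inter> W = {}"
    and \<sigma>: "\<forall>w\<in>W. \<sigma> w = Var w" "\<forall>w. w \<notin> W \<longrightarrow> vars (\<sigma> w) \<inter> W = {}"
    and S': "\<forall>s\<in>S. dy \<Sigma> S' (tsub \<sigma> s)"
    and "bv \<gamma> \<subseteq> W"
  shows "derives \<Sigma> R S' (asub \<sigma> ` A) (asub \<sigma> \<gamma>)"
proof -
  have cap: "vars (\<sigma> w) \<inter> B = {}" if "B \<subseteq> W" "w \<notin> B" for w B
    using \<sigma> that by (cases "w \<in> W") fastforce+
  have reg: "regular (asub \<sigma> \<gamma>)" if "regular \<gamma>" "bv \<gamma> \<subseteq> W" for \<gamma> :: "('p, 'f, 'n, 'v) assn"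
    using that cap by (intro regular_asub) (auto simp: regular_def)
  show ?thesis
    using assms(1) S0(1) S' \<open>bv \<gamma> \<subseteq> W\<close>
  proof (induction rule: derives.induct)
    case (ax \<alpha> A S)
    then show ?case by (auto intro: derives.ax)
  next
    case (eq S t A)
    then show ?case
      using dy_tsub[OF eq(2) _ wf] by (auto intro: derives.eq)
  next
    case (cons ts f us S A)
    then have "\<forall>j<arity \<Sigma> f. derives \<Sigma> R S' (asub \<sigma> ` A) (Eq (map (tsub \<sigma>) ts ! j) (map (tsub \<sigma>) us ! j))"
      by simp
    then show ?case
      using cons(1-3) by (auto intro: derives.cons)
  next
    case (sym S A t u)
    then show ?case by (auto intro: derives.sym)
  next
    case (trans ts k S A)
    then have "\<forall>j<k. derives \<Sigma> R S' (asub \<sigma> ` A) (Eq (map (tsub \<sigma>) ts ! j) (map (tsub \<sigma>) ts ! Suc j))"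
      by simp
    then have "derives \<Sigma> R S' (asub \<sigma> ` A) (Eq (map (tsub \<sigma>) ts ! 0) (map (tsub \<sigma>) ts ! k))"
      using trans(1-3) by (intro derives.trans) auto
    then show ?case
      using trans(2,3) by simp
  next
    case (proj S A f ts us i)
    have "[i] \<in> abs_pos \<Sigma> S (Fn f ts)" "[i] \<in> abs_pos \<Sigma> S (Fn f us)"
      using proj(5,6) by auto
    then have dy: "dy \<Sigma> S (Fn f ts)" "\<forall>u\<in>set ts. dy \<Sigma> S u" "dy \<Sigma> S (Fn f us)" "\<forall>u\<in>set us. dy \<Sigma> S u"
      using abs_pos_children proj(3-5) by metis+
    have "dy \<Sigma> S' (tsub \<sigma> t)" if "dy \<Sigma> S t" for t
      using dy_tsub[OF that _ wf] proj.prems by blast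
    then have dy': "dy \<Sigma> S' (tsub \<sigma> (Fn f ts))" "\<forall>u\<in>set ts. dy \<Sigma> S' (tsub \<sigma> u)"
      "dy \<Sigma> S' (tsub \<sigma> (Fn f us))" "\<forall>u\<in>set us. dy \<Sigma> S' (tsub \<sigma> u)"
      using dy by blast+
    have "derives \<Sigma> R S' (asub \<sigma> ` A) (Eq (map (tsub \<sigma>) ts ! i) (map (tsub \<sigma>) us ! i))"
    proof (rule derives.proj[where f = f])
      show "derives \<Sigma> R S' (asub \<sigma> ` A) (Eq (Fn f (map (tsub \<sigma>) ts)) (Fn f (map (tsub \<sigma>) us)))"
        using proj.IH proj.prems by simp
      show "\<forall>j<arity \<Sigma> f. {[0, j], [1, j]} \<subseteq> abs_pos_assn \<Sigma> S'
          (Eq (Fn f (map (tsub \<sigma>) ts)) (Fn f (map (tsub \<sigma>) us)) :: ('p, 'f, 'n, 'v) assn)"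
        using dy' proj(3,4) by (auto simp: Cons_abs_pos Nil_abs_pos)
    qed (use proj in auto)
    then show ?case
      using proj(3-5) by simp
  next
    case (conjI S A \<alpha> \<beta>)
    have "regular (asub \<sigma> (Conj \<alpha> \<beta>))"
      using conjI.hyps(4) conjI.prems(3) by (rule reg)
    then show ?case
      using conjI by (auto intro: derives.conjI)
  next
    case (subst S A t ns u)
    then show ?case by (auto intro: derives.subst)
  next
    case (exI P x \<alpha> S A t)
    have x: "x \<in> W" "\<sigma> x = Var x" "\<sigma>(x := Var x) = \<sigma>" "bv \<alpha> \<subseteq> W" "x \<notin> bv \<alpha>" "distinct_bv \<alpha>"
      using exI.prems(3) \<sigma>(1) exI.hyps(7) by (auto simp: regular_def)
    have nx: "\<forall>w. w \<noteq> x \<longrightarrow> x \<notin> vars (\<sigma> w)"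
      using cap[of "{x}"] x(1) by auto
    have cap: "vars (\<sigma> w) \<inter> bv \<alpha> = {}" if "w \<notin> bv \<alpha>" for w
      using cap that x(4) by blast
    have fv: "w \<notin> bv \<alpha>" if "w \<in> fv \<alpha>" for w
      using exI.hyps(7) that x(5) by (auto simp: regular_def)
    \<comment> \<open>Putting \<open>t\<close> for \<open>x\<close> and then applying
      \<open>\<sigma>\<close> equals applying \<open>\<sigma>\<close> and then putting
      \<open>tsub \<sigma> t\<close> for \<open>x\<close>, since \<open>\<sigma>\<close> fixes
      \<open>x\<close> and no other value contains it.\<close>
    have "asub \<sigma> (asub (Var(x := t)) \<alpha>) = asub (\<lambda>w. tsub \<sigma> ((Var(x := t)) w)) \<alpha>"
      by (rule asub_asub) (use exI.hyps(8) fv x(6) in auto)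
    also have "\<dots> = asub (\<lambda>w. tsub (Var(x := tsub \<sigma> t)) (\<sigma> w)) \<alpha>"
    proof (rule asub_cong)
      fix w
      show "tsub \<sigma> ((Var(x := t)) w) = tsub (Var(x := tsub \<sigma> t)) (\<sigma> w)"
      proof (cases "w = x")
        case False
        have "tsub (Var(x := tsub \<sigma> t)) (\<sigma> w) = tsub Var (\<sigma> w)"
          using nx False by (intro tsub_cong) auto
        then show ?thesis using False by simp
      qed (simp add: x(2))
    qed
    also have "\<dots> = asub (Var(x := tsub \<sigma> t)) (asub \<sigma> \<alpha>)"
      by (rule asub_asub[symmetric]) (use cap fv x(6) in auto)
    finally have eq: "asub \<sigma> (asub (Var(x := t)) \<alpha>) = asub (Var(x := tsub \<sigma> t)) (asub \<sigma> \<alpha>)" .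
    have rep: "replace_assn \<alpha> P t = asub (Var(x := t)) \<alpha>"
      unfolding exI.hyps(2) by (rule replace_pos_of_assn[OF x(5)])
    have "derives \<Sigma> R S' (asub \<sigma> ` A) (Ex x (asub \<sigma> \<alpha>))"
    proof (rule derives_exI)
      show "derives \<Sigma> R S' (asub \<sigma> ` A) (asub (Var(x := tsub \<sigma> t)) (asub \<sigma> \<alpha>))"
        using exI.IH exI.prems(1,2) x(4) unfolding rep eq by simp
      show "dy \<Sigma> S' (tsub \<sigma> t)"
        using exI.hyps(4) exI.prems(2) wf by (rule dy_tsub)
      show "abstr_assn \<Sigma> (S' \<union> {Var x}) x (asub \<sigma> \<alpha>)"
      proof (rule abstr_assn_asub[OF _ _ wf x(2) nx])
        show "abstr_assn \<Sigma> (S \<union> {Var x}) x \<alpha>"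
          using exI.hyps(2,5) by (simp add: abstr_assn_def)
        show "\<forall>s\<in>S \<union> {Var x}. dy \<Sigma> (S' \<union> {Var x}) (tsub \<sigma> s)"
          using exI.prems(2) x(2) by (auto intro: dy_mono dy_ax)
        show "S \<union> {Var x} \<subseteq> S0 \<union> range Var"
          using exI.prems(1) by auto
      qed (use S0(2) x in auto)
      show "vars (tsub \<sigma> t) \<inter> bv (asub \<sigma> \<alpha>) = {}"
        using cap exI.hyps(8) by (fastforce simp: vars_tsub)
      have "regular (asub \<sigma> (Ex x \<alpha>))"
        using exI.hyps(7) exI.prems(3) by (rule reg)
      then show "regular (Ex x (asub \<sigma> \<alpha>))"
        using x(3) by simp
    qed (use exI in auto)
    then show ?case using x(3) by simp
  next
    case (say S A \<alpha> k)
    have "regular (asub \<sigma> (Says k \<alpha>))"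
      using say.hyps(4) say.prems(3) by (rule reg)
    then show ?case
      using say dy_tsub[OF say.hyps(3) say.prems(2) wf] by (auto intro: derives.say)
  next
    case (prom S A t n)
    then show ?case by (auto intro: derives.prom)
  next
    case (int ls S A t ns)
    then have "\<forall>l\<in>set ls. derives \<Sigma> R S' (asub \<sigma> ` A) (Mem (tsub \<sigma> t) l)"
      by simp
    from derives.int[OF int(1,2) this int.hyps(3)] show ?case
      by simp
  next
    case (wk n ns S A t)
    have "dy \<Sigma> S' (Name n')" if "n' \<in> set ns" for n'
      using dy_tsub[OF wk(4)[rule_format, OF that] wk.prems(2) wf] by simp
    then show ?case
      using wk by (auto intro!: derives.wk[where n = n])
  qed (use R in simp_all)
qed

section \<open>Variables bound below \<open>says\<close>, and a derivable term to replace
  them\<close>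

lemma fv_at: "\<gamma> \<in> at \<beta> \<Longrightarrow> fv \<gamma> \<subseteq> fv \<beta> \<union> obv \<beta>"
  by (induction \<beta>) auto

lemma bv_at: "\<gamma> \<in> at \<beta> \<Longrightarrow> bv \<gamma> \<subseteq> bv \<beta>"
  by (induction \<beta>) auto

lemma not_obvD: "z \<in> bv \<beta> \<Longrightarrow> z \<notin> obv \<beta> \<Longrightarrow> \<exists>k \<gamma>. Says k \<gamma> \<in> at \<beta>"
  by (induction \<beta>) auto

lemma st_size: "s \<in> st t \<Longrightarrow> s \<noteq> t \<Longrightarrow> size s < size t"
proof (induction t)
  case (Fn f ts)
  then obtain u where u: "u \<in> set ts" "s \<in> st u" by auto
  then have "size s \<le> size u"
    using Fn.IH by (cases "s = u") (auto intro: less_imp_le)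
  also have "size u < size (Fn f ts)"
    using u(1) by (simp add: le_imp_less_Suc size_list_estimation')
  finally show ?case .
qed auto

lemma finite_st_assn: "finite (st_assn \<Sigma> \<beta>)"
proof -
  have st: "finite (st t)" for t :: "('f, 'n, 'v) trm"
    by (induction t) auto
  show ?thesis
    by (induction \<beta>) (auto simp: st)
qed

text \<open>The key of an assertion \<open>pk(k) says \<gamma>\<close> in \<open>\<beta>\<close> provides the term: either a bound variable
  occurs in \<open>k\<close>, or \<open>pk(k)\<close> lies below a member of \<open>pubs(\<beta>)\<close>.\<close>

lemma derivable_term:
  fixes S :: "('f, 'n, 'v) trm set"
  assumes "z \<in> bv \<beta>" "z \<notin> obv \<beta>" "fv \<beta> \<inter> Vq \<Sigma> = {}" "\<forall>t\<in>pubs \<Sigma> \<beta>. dy \<Sigma> S t"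
  shows "\<exists>u. dy \<Sigma> (S \<union> Var ` obv \<beta>) u"
proof -
  obtain k \<gamma> where k: "Says k \<gamma> \<in> at \<beta>"
    using not_obvD[OF assms(1,2)] by blast
  show ?thesis
  proof (cases "vars k \<inter> Vq \<Sigma> = {}")
    case True
    have pk: "Fn (pk \<Sigma>) [k] \<in> st_assn \<Sigma> \<beta>"
      using k by (induction \<beta>) auto
    define M where "M = {t \<in> st_assn \<Sigma> \<beta>. vars t \<inter> Vq \<Sigma> = {}}"
    have "finite M"
      unfolding M_def by (simp add: finite_st_assn)
    moreover have "M \<noteq> {}"
      using pk True unfolding M_def by force
    \<comment> \<open>A candidate of maximal size is maximal for the subterm order, since any proper
      superterm is larger.\<close>
    ultimately have "Max (size ` M) \<in> size ` M"
      by (intro Max_in) simp_all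
    then obtain t where t: "t \<in> M" "size t = Max (size ` M)"
      by auto
    have "t' = t" if "t' \<in> M" "t \<in> st t'" for t'
    proof (rule ccontr)
      assume "t' \<noteq> t"
      then have "size t < size t'"
        using st_size[OF that(2)] by simp
      moreover have "size t' \<le> Max (size ` M)"
        using that(1) \<open>finite M\<close> by simp
      ultimately show False using t(2) by simp
    qed
    then have "t \<in> pubs \<Sigma> \<beta>"
      using t(1) by (simp add: pubs_def M_def)
    then show ?thesis
      using assms(4) by (blast intro: dy_mono)
  next
    case False
    then obtain y where "y \<in> vars k" "y \<in> Vq \<Sigma>" by blast
    then have "y \<in> obv \<beta>"
      using fv_at[OF k] assms(3) by auto
    then show ?thesis
      by (intro HOL.exI[of _ "Var y"] dy_ax) simp
  qed
qed

theorem theorem2: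
  fixes \<Sigma> :: "('f, 'v) signature"
    and S T :: "('f, 'n, 'v) trm set"
    and A E :: "('p, 'f, 'n, 'v) assn set"
    and \<alpha> :: "('p, 'f, 'n, 'v) assn"
  assumes "dy_system \<Sigma> TYPE('n)"
    and "finite S" and "\<forall>t\<in>S. wf_trm \<Sigma> t"
    and "finite A" and "\<forall>\<beta>\<in>A. wf_assn \<Sigma> \<beta>"
    and "wf_assn \<Sigma> \<alpha>"
    and "bv_convention S (insert \<alpha> A)"
    and "fv_seq S A \<inter> Vq \<Sigma> = {}"
    and "\<forall>\<beta>\<in>A. \<forall>t\<in>pubs \<Sigma> \<beta>. dy \<Sigma> S t"
    and "(T, E) = ker S A"
    and "bv \<alpha> \<inter> vars_seq S A = {}"
  shows "derives_a \<Sigma> S A \<alpha> \<longleftrightarrow>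
    (\<exists>X (\<mu> :: 'v \<rightharpoonup> ('f, 'n, 'v) trm).
       X \<subseteq> hat \<alpha> \<and> dom \<mu> = bv \<alpha> - bvs X \<and>
       (\<forall>x\<in>dom \<mu>. dy \<Sigma> T (the (\<mu> x))) \<and>
       (\<forall>\<beta>\<in>X. derives_eq \<Sigma> T E (subst_assn \<mu> \<beta>)) \<and>
       derives_intro \<Sigma> T (subst_assn \<mu> ` X) \<alpha> \<and>
       (\<forall>x\<in>dom \<mu>. \<forall>t\<in>st_assn \<Sigma> \<alpha>. pos_of (Var x) t \<subseteq> abs_pos \<Sigma> (T \<union> Var ` dom \<mu>) t))"
    (is "_ \<longleftrightarrow> (\<exists>X \<mu>. ?N X \<mu>)")
proof -
  let ?D = "bv \<alpha>"
  have wf: "\<forall>d\<in>drules \<Sigma>. wf_drule \<Sigma> d"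
    using assms(1) by (simp add: dy_system_def)
  have T: "T = S \<union> Var ` bvs A" and E: "E = (\<Union>\<beta>\<in>A. at \<beta>)"
    using assms(10) by (auto simp: ker_def)
  have SD: "(\<Union>s\<in>S. vars s) \<inter> ?D = {}" and bvD: "\<forall>\<beta>\<in>A. bv \<beta> \<inter> ?D = {}"
    and fvD: "\<forall>\<beta>\<in>A. fv \<beta> \<inter> ?D = {}"
    using assms(11) by (auto simp: vars_seq_def)
  have TD: "(\<Union>t\<in>T. vars t) \<inter> ?D = {}"
    using SD bvD by (auto simp: T bvs_def)
  have reg\<alpha>: "regular \<alpha>" and regA: "\<forall>\<beta>\<in>A. regular \<beta>"
    using assms(7) by (auto simp: bv_convention_def regular_def fv_seq_def bvs_def)
  have ED: "\<forall>\<beta>\<in>E. bv \<beta> \<inter> ?D = {}"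
    using bvD bv_at unfolding E by fastforce
  have bvA: "fv_seq S A \<inter> bvs A = {}" "fv \<alpha> \<inter> bvs A = {}"
    using assms(7) by (auto simp: bv_convention_def fv_seq_def bvs_def)
  show ?thesis
  proof
    assume der: "derives_a \<Sigma> S A \<alpha>"
    text \<open>Soundness needs an environment whose values avoid \<open>bv \<alpha>\<close>; the variables in
      \<open>bv \<alpha>\<close> do not occur free, so their values are irrelevant.\<close>
    define \<sigma> :: "'v \<Rightarrow> ('f, 'n, 'v) trm" where
      "\<sigma> w = (if w \<in> ?D then Name undefined else Var w)" for w
    have "sat \<Sigma> T E ?D \<sigma> \<alpha>"
    proof (rule derives_sat[OF der wf TD SD regA])
      show "\<forall>w. vars (\<sigma> w) \<inter> ?D = {}"
        by (simp add: \<sigma>_def)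
      show "\<forall>s\<in>S. dy \<Sigma> T (tsub \<sigma> s)"
      proof
        fix s assume s: "s \<in> S"
        then have "tsub \<sigma> s = tsub Var s"
          using SD by (intro tsub_cong) (auto simp: \<sigma>_def)
        then show "dy \<Sigma> T (tsub \<sigma> s)"
          using s by (simp add: T dy_ax)
      qed
      show "\<forall>\<beta>\<in>A. sat \<Sigma> T E ?D \<sigma> \<beta>"
      proof
        fix \<beta> assume \<beta>: "\<beta> \<in> A"
        then have "sat \<Sigma> T E ?D Var \<beta>"
          using bvD by (intro sat_at) (auto simp: E T bvs_def)
        moreover have "sat \<Sigma> T E ?D \<sigma> \<beta> = sat \<Sigma> T E ?D Var \<beta>"
          using fvD \<beta> by (intro sat_cong) (auto simp: \<sigma>_def)
        ultimately show "sat \<Sigma> T E ?D \<sigma> \<beta>" by simp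
      qed
    qed simp
    moreover have "sat \<Sigma> T E ?D \<sigma> \<alpha> = sat \<Sigma> T E ?D Var \<alpha>"
      using reg\<alpha> by (intro sat_cong) (auto simp: \<sigma>_def regular_def)
    ultimately have "sat \<Sigma> T E ?D Var \<alpha>"
      by simp
    moreover have "\<forall>w\<in>fv \<alpha>. w \<notin> ?D"
      using reg\<alpha> by (auto simp: regular_def)
    ultimately
    obtain X \<rho> where X: "X \<subseteq> hat \<alpha>" "bvs X = {}" "\<forall>x. x \<notin> ?D \<longrightarrow> \<rho> x = Var x"
      "\<forall>x\<in>?D. dy \<Sigma> T (\<rho> x)" "\<forall>\<beta>\<in>X. derives_eq \<Sigma> T E (asub \<rho> \<beta>)"
      "derives_intro \<Sigma> T (asub \<rho> ` X) \<alpha>" "\<forall>x\<in>?D. abstr_assn \<Sigma> (T \<union> Var ` ?D) x \<alpha>"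
      using sat_extract[OF wf TD ED _ assms(6) reg\<alpha> order_refl, of Var "{}"] by auto
    \<comment> \<open>Since \<open>X\<close> has no bound variables, the required domain is all of
      \<open>bv \<alpha>\<close>.\<close>
    define \<mu> where "\<mu> x = (if x \<in> ?D then Some (\<rho> x) else None)" for x
    have dom: "dom \<mu> = ?D"
      by (auto simp: \<mu>_def dom_def)
    have "(\<lambda>x. case \<mu> x of None \<Rightarrow> Var x | Some t \<Rightarrow> t) = \<rho>"
      using X(3) by (auto simp: \<mu>_def)
    then have \<mu>: "subst_assn \<mu> \<beta> = asub \<rho> \<beta>" for \<beta> :: "('p, 'f, 'n, 'v) assn"
      by (simp add: subst_assn_asub)
    have "pos_of (Var x) t \<subseteq> abs_pos \<Sigma> (T \<union> Var ` ?D) t" if "x \<in> ?D" "t \<in> st_assn \<Sigma> \<alpha>" for x t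
      using abstr_assn_st[of \<Sigma> "T \<union> Var ` ?D" x \<alpha> t] X(7) that by (auto simp: abstr_def)
    then have "?N X \<mu>"
      unfolding dom \<mu> using X by (auto simp: \<mu>_def)
    then show "\<exists>X \<mu>. ?N X \<mu>" by blast
  next
    assume "\<exists>X \<mu>. ?N X \<mu>"
    then obtain X and \<mu> :: "'v \<rightharpoonup> ('f, 'n, 'v) trm" where
      b: "\<forall>\<beta>\<in>X. derives_eq \<Sigma> T E (subst_assn \<mu> \<beta>)" and
      c: "derives_intro \<Sigma> T (subst_assn \<mu> ` X) \<alpha>"
      by blast
    \<comment> \<open>These are exactly the equality rules together with the introduction rules, so
      (b) and (c) compose by cut within \<open>?R\<close>.\<close>
    let ?R = "UNIV - {R_conjE, R_exE}"
    have "derives \<Sigma> ?R T E \<beta>" if "\<beta> \<in> subst_assn \<mu> ` X" for \<beta>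
    proof -
      have "derives_eq \<Sigma> T E \<beta>" using b that by blast
      then show ?thesis by (rule derives_cut) (auto intro: derives.ax)
    qed
    then have d: "derives \<Sigma> ?R T E \<alpha>"
      by (intro derives_cut[OF c]) auto

    text \<open>The kernel contains the variables \<open>Z\<close> bound below \<open>says\<close>, which (\<open>\<exists>E\<close>) cannot free.
      They do not occur free in \<open>E\<close> or \<open>\<alpha>\<close> and can be replaced by any derivable term.\<close>
    define V where "V = (\<Union>\<beta>\<in>A. obv \<beta>)"
    define Z where "Z = bvs A - V"
    let ?T = "S \<union> Var ` V"
    \<comment> \<open>The implication inside the quantifier gives one fixed \<open>u\<close> even if
      \<open>Z\<close> is empty, when its value is arbitrary.\<close>
    have "\<exists>u. Z \<noteq> {} \<longrightarrow> dy \<Sigma> ?T u"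
    proof (cases "Z = {}")
      case False
      then obtain z \<beta> where z: "\<beta> \<in> A" "z \<in> bv \<beta>" "z \<notin> obv \<beta>"
        by (auto simp: Z_def V_def bvs_def)
      then have "\<exists>u. dy \<Sigma> (S \<union> Var ` obv \<beta>) u"
        using assms(8,9) by (intro derivable_term) (auto simp: fv_seq_def)
      then show ?thesis
        using z(1) by (auto simp: V_def intro: dy_mono)
    qed simp
    then obtain u where u: "Z \<noteq> {} \<Longrightarrow> dy \<Sigma> ?T u" by blast
    have VA: "V \<subseteq> bvs A"
      using obv_bv by (fastforce simp: V_def bvs_def)
    define \<sigma> :: "'v \<Rightarrow> ('f, 'n, 'v) trm" where "\<sigma> w = (if w \<in> Z then u else Var w)" for w
    have ZD: "Z \<inter> ?D = {}"
      using bvD by (auto simp: Z_def bvs_def)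
    have E\<sigma>: "asub \<sigma> \<gamma> = \<gamma>" if "\<gamma> \<in> E" for \<gamma>
    proof -
      \<comment> \<open>\<open>at\<close> stops at \<open>Says\<close>, so a variable free in an
        atom of \<beta> is free in \<beta> or belongs to \<open>obv \<beta>\<close>, and
        \<open>Z\<close> avoids both.\<close>
      have "fv \<gamma> \<inter> Z = {}"
        using that fv_at[of \<gamma>] bvA(1) by (fastforce simp: E Z_def V_def fv_seq_def)
      then have "asub \<sigma> \<gamma> = asub Var \<gamma>"
        by (intro asub_cong) (auto simp: \<sigma>_def)
      then show ?thesis by simp
    qed
    have "asub \<sigma> \<alpha> = asub Var \<alpha>"
      using bvA(2) by (intro asub_cong) (auto simp: \<sigma>_def Z_def)
    moreover have "derives \<Sigma> ?R ?T (asub \<sigma> ` E) (asub \<sigma> \<alpha>)"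
    proof (rule derives_asub[OF d _ _ wf _ SD])
      show "\<forall>w\<in>?D. \<sigma> w = Var w"
        using ZD by (auto simp: \<sigma>_def)
      show "\<forall>w. w \<notin> ?D \<longrightarrow> vars (\<sigma> w) \<inter> ?D = {}"
      proof (intro allI impI)
        fix w assume w: "w \<notin> ?D"
        show "vars (\<sigma> w) \<inter> ?D = {}"
        proof (cases "w \<in> Z")
          case True
          then have "vars u \<subseteq> (\<Union>t\<in>?T. vars t)"
            using u dy_vars[OF _ wf] by blast
          moreover have "(\<Union>t\<in>?T. vars t) \<subseteq> (\<Union>t\<in>T. vars t)"
            using VA by (auto simp: T)
          ultimately have "vars u \<inter> ?D = {}"
            using TD by blast
          then show ?thesis
            using True by (simp add: \<sigma>_def)
        qed (use w in \<open>simp add: \<sigma>_def\<close>)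
      qed
      show "\<forall>s\<in>T. dy \<Sigma> ?T (tsub \<sigma> s)"
      proof
        fix s assume "s \<in> T"
        then consider "s \<in> S" | z where "s = Var z" "z \<in> bvs A"
          by (auto simp: T)
        then show "dy \<Sigma> ?T (tsub \<sigma> s)"
        proof cases
          case 1
          then have "tsub \<sigma> s = tsub Var s"
            using bvA(1) by (intro tsub_cong) (auto simp: \<sigma>_def Z_def fv_seq_def)
          then show ?thesis using 1 by (simp add: dy_ax)
        next
          case 2
          then show ?thesis
            using u by (auto simp: \<sigma>_def Z_def intro: dy_ax)
        qed
      qed
    qed (auto simp: T)
    ultimately have d': "derives \<Sigma> ?R ?T E \<alpha>"
      using E\<sigma> by simp
    show "derives_a \<Sigma> S A \<alpha>"
    proof (rule elim_assns[OF assms(4)])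
      show "\<forall>\<beta>\<in>A. derives_stably \<Sigma> S A \<beta> \<and> distinct_bv \<beta> \<and> fv \<beta> \<subseteq> fv_seq S A \<and>
          bv \<beta> \<inter> (fv_seq S A \<union> fv \<alpha>) = {}"
        using bvA regA
        by (fastforce simp: derives_stably_def regular_def fv_seq_def bvs_def intro: derives.ax)
      show "\<forall>\<beta>\<in>A. \<forall>\<delta>\<in>A. \<beta> \<noteq> \<delta> \<longrightarrow> bv \<beta> \<inter> bv \<delta> = {}"
        using assms(7) by (auto simp: bv_convention_def)
      fix S' A'
      assume "S \<union> Var ` (\<Union>\<beta>\<in>A. obv \<beta>) \<subseteq> S'" "A \<subseteq> A'" "\<forall>\<beta>\<in>A. \<forall>\<delta>\<in>at \<beta>. derives_stably \<Sigma> S' A' \<delta>"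
      then show "derives_a \<Sigma> S' A' \<alpha>"
        by (intro derives_cut[OF d']) (auto simp: V_def E intro: derives_stablyD)
    qed
  qed
qed

end
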